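(* Let $S,T\in\widehat{\mathcal{C}}_\hbar$ be invertible, let $h$ be the hermitian form on $\mathcal{X}(\widehat{\mathcal{C}}_\hbar)$ with $h(\Phi,\Phi)=S$, $h(\bar\Phi,\bar\Phi)=T$, $h(\Phi,\bar\Phi)=0$, and let $\nabla$ be the connection on $\mathcal{X}(\widehat{\mathcal{C}}_\hbar)$ given by $$\nabla_\partial\Phi=\Phi\,S^{-1}\partial S,\qquad \nabla_{\bar\partial}\bar\Phi=\bar\Phi\,T^{-1}\bar\partial T,\qquad \nabla_{\bar\partial}\Phi=\nabla_\partial\bar\Phi=0.$$ Then its curvature $R(\partial,\bar\partial)X=\nabla_\partial\nabla_{\bar\partial}X-\nabla_{\bar\partial}\nabla_\partial X$ satisfies $$R(\partial,\bar\partial)\Phi=-\Phi\,\bar\partial\big(S^{-1}\partial S\big),\qquad R(\partial,\bar\partial)\bar\Phi=\bar\Phi\,\partial\big(T^{-1}\bar\partial T\big).$$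
   Context: Let $\hbar\in\mathbb{R}$. $\mathcal{C}_\hbar$ is the unital associative $\mathbb{C}$-algebra with generators $U,R,R^{-1},W,W^{-1}$ and relations $WW^{-1}=W^{-1}W=1$, $RR^{-1}=R^{-1}R=1$, $RU=UR$, $R^{-1}U=UR^{-1}$, $WR=e^{\hbar}RW$, $WR^{-1}=e^{-\hbar}R^{-1}W$, $W^{-1}R=e^{-\hbar}RW^{-1}$, $W^{-1}R^{-1}=e^{\hbar}R^{-1}W^{-1}$, $WU=UW+\hbar W$, $W^{-1}U=UW^{-1}-\hbar W^{-1}$. It is a $*$-algebra via $U^*=U$, $R^*=R$, $W^*=W^{-1}$. Localization: let $Z_\hbar(U,R)$ be the commutative subalgebra generated by $1,U,R,R^{-1}$, let $\phi:Z_\hbar(U,R)\to C^\infty(\mathbb{R})$ be the algebra homomorphism $\phi(U)=u$, $\phi(R)=e^u$, $\phi(R^{-1})=e^{-u}$, and let $Z^+_\hbar(U,R)=\{p\in Z_\hbar(U,R):|\phi(p)(u)|>0\ \forall u\in\mathbb{R}\}$. $\widehat{\mathcal{C}}_\hbar$ is the universal localization of $\mathcal{C}_\hbar$ at $Z^+_\hbar(U,R)$ (the universal algebra receiving a homomorphism from $\mathcal{C}_\hbar$ under which all elements of $Z_\hbar^+(U,R)$ become invertible); $\mathcal{C}_\hbar$ embeds in it. The involution and derivations of $\mathcal{C}_\hbar$ are extended to $\widehat{\mathcal{C}}_\hbar$. Derivations: $\partial_u,\partial_v$ are the commuting hermitian derivations with $\partial_uU=1$, $\partial_uR=R$, $\partial_uW=0$,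 $\partial_vU=0$, $\partial_vR=0$, $\partial_vW=iW$. Let $\partial=\frac12(\partial_u-i\partial_v)$, $\bar\partial=\frac12(\partial_u+i\partial_v)$, and let $\mathfrak{g}$ be the complex abelian Lie algebra spanned by $\partial_u,\partial_v$. Module: $e_1,e_2,e_3$ is the canonical basis of the free right module $(\widehat{\mathcal{C}}_\hbar)^3$; $\Phi^1=\frac12e^{\hbar/2}(RW-R^{-1}W^{-1})$, $\Phi^2=-\frac i2e^{\hbar/2}(RW+R^{-1}W^{-1})$, $\Phi^3=1$; $\Phi=\sum_ie_i\Phi^i$, $\bar\Phi=\sum_ie_i(\Phi^i)^*$; $\mathcal{X}(\widehat{\mathcal{C}}_\hbar)$ is the right submodule generated by $\Phi,\bar\Phi$, which is free with basis $\{\Phi,\bar\Phi\}$. A hermitian form satisfies $h(X,Y+Z)=h(X,Y)+h(X,Z)$, $h(X,Y)^*=h(Y,X)$, $h(X,Ya)=h(X,Y)a$. A connection is a map $\nabla:\mathfrak{g}\times\mathcal{X}(\widehat{\mathcal{C}}_\hbar)\to\mathcal{X}(\widehat{\mathcal{C}}_\hbar)$, $\mathbb{C}$-linear in each argument, with $\nabla_d(Xa)=(\nabla_dX)a+X\,d(a)$ for $a\in\widehat{\mathcal{C}}_\hbar$. *)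

theory Defs
  imports "HOL-Algebra.Module" "HOL-Analysis.Finite_Cartesian_Product"
begin

section \<open>Unital associative complex algebras\<close>

locale cx_algebra = ring A for A :: "(complex, 'a) module" (structure) +
  assumes smult_closed: "x \<in> carrier A \<Longrightarrow> c \<odot> x \<in> carrier A"
    and smult_l_distr: "x \<in> carrier A \<Longrightarrow> (c + d) \<odot> x = c \<odot> x \<oplus> d \<odot> x"
    and smult_r_distr: "x \<in> carrier A \<Longrightarrow> y \<in> carrier A \<Longrightarrow> c \<odot> (x \<oplus> y) = c \<odot> x \<oplus> c \<odot> y"
    and smult_smult: "x \<in> carrier A \<Longrightarrow> (c * d) \<odot> x = c \<odot> (d \<odot> x)"
    and smult_one: "x \<in> carrier A \<Longrightarrow> 1 \<odot> x = x"
    and smult_mult_l: "x \<in> carrier A \<Longrightarrow> y \<in> carrier A \<Longrightarrow> (c \<odot> x) \<otimes> y = c \<odot> (x \<otimes> y)"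
    and smult_mult_r: "x \<in> carrier A \<Longrightarrow> y \<in> carrier A \<Longrightarrow> x \<otimes> (c \<odot> y) = c \<odot> (x \<otimes> y)"

definition alg_hom ::
  "(complex, 'a) module \<Rightarrow> (complex, 'b) module \<Rightarrow> ('a \<Rightarrow> 'b) \<Rightarrow> bool" where
  "alg_hom A B f \<longleftrightarrow>
     (\<forall>x \<in> carrier A. f x \<in> carrier B) \<and>
     (\<forall>x \<in> carrier A. \<forall>y \<in> carrier A. f (x \<oplus>\<^bsub>A\<^esub> y) = f x \<oplus>\<^bsub>B\<^esub> f y) \<and>
     (\<forall>x \<in> carrier A. \<forall>y \<in> carrier A. f (x \<otimes>\<^bsub>A\<^esub> y) = f x \<otimes>\<^bsub>B\<^esub> f y) \<and>
     (\<forall>c. \<forall>x \<in> carrier A. f (c \<odot>\<^bsub>A\<^esub> x) = c \<odot>\<^bsub>B\<^esub> f x) \<and>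
     f \<one>\<^bsub>A\<^esub> = \<one>\<^bsub>B\<^esub>"

inductive_set gen_subalg :: "(complex, 'a) module \<Rightarrow> 'a set \<Rightarrow> 'a set"
  for A :: "(complex, 'a) module" and X :: "'a set" where
  sub_gen: "x \<in> X \<Longrightarrow> x \<in> gen_subalg A X"
| sub_one: "\<one>\<^bsub>A\<^esub> \<in> gen_subalg A X"
| sub_smult: "x \<in> gen_subalg A X \<Longrightarrow> c \<odot>\<^bsub>A\<^esub> x \<in> gen_subalg A X"
| sub_add: "x \<in> gen_subalg A X \<Longrightarrow> y \<in> gen_subalg A X \<Longrightarrow> x \<oplus>\<^bsub>A\<^esub> y \<in> gen_subalg A X"
| sub_mult: "x \<in> gen_subalg A X \<Longrightarrow> y \<in> gen_subalg A X \<Longrightarrow> x \<otimes>\<^bsub>A\<^esub> y \<in> gen_subalg A X"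

definition is_involution :: "(complex, 'a) module \<Rightarrow> ('a \<Rightarrow> 'a) \<Rightarrow> bool" where
  "is_involution A s \<longleftrightarrow>
     (\<forall>x \<in> carrier A. s x \<in> carrier A) \<and>
     (\<forall>x \<in> carrier A. \<forall>y \<in> carrier A. s (x \<oplus>\<^bsub>A\<^esub> y) = s x \<oplus>\<^bsub>A\<^esub> s y) \<and>
     (\<forall>c. \<forall>x \<in> carrier A. s (c \<odot>\<^bsub>A\<^esub> x) = cnj c \<odot>\<^bsub>A\<^esub> s x) \<and>
     (\<forall>x \<in> carrier A. \<forall>y \<in> carrier A. s (x \<otimes>\<^bsub>A\<^esub> y) = s y \<otimes>\<^bsub>A\<^esub> s x) \<and>
     (\<forall>x \<in> carrier A. s (s x) = x)"

definition is_derivation :: "(complex, 'a) module \<Rightarrow> ('a \<Rightarrow> 'a) \<Rightarrow> bool" where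
  "is_derivation A d \<longleftrightarrow>
     (\<forall>x \<in> carrier A. d x \<in> carrier A) \<and>
     (\<forall>x \<in> carrier A. \<forall>y \<in> carrier A. d (x \<oplus>\<^bsub>A\<^esub> y) = d x \<oplus>\<^bsub>A\<^esub> d y) \<and>
     (\<forall>c. \<forall>x \<in> carrier A. d (c \<odot>\<^bsub>A\<^esub> x) = c \<odot>\<^bsub>A\<^esub> d x) \<and>
     (\<forall>x \<in> carrier A. \<forall>y \<in> carrier A.
        d (x \<otimes>\<^bsub>A\<^esub> y) = (d x \<otimes>\<^bsub>A\<^esub> y) \<oplus>\<^bsub>A\<^esub> (x \<otimes>\<^bsub>A\<^esub> d y))"

section \<open>Algebras given by generators and relations\<close>

datatype 'g alg_term =
  Gen 'g | Cst complex | Add "'g alg_term" "'g alg_term" | Mul "'g alg_term" "'g alg_term"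

text \<open>The least congruence on the terms over \<open>G\<close> that contains the relations \<open>Rel\<close> and the laws
  of unital associative complex algebras; \<open>Cst c\<close> stands for \<open>c\<close> times the unit.\<close>

inductive alg_eq ::
  "'g set \<Rightarrow> ('g alg_term \<times> 'g alg_term) set \<Rightarrow> 'g alg_term \<Rightarrow> 'g alg_term \<Rightarrow> bool"
  for G :: "'g set" and Rel :: "('g alg_term \<times> 'g alg_term) set" where
  eq_refl: "set_alg_term t \<subseteq> G \<Longrightarrow> alg_eq G Rel t t"
| eq_sym: "alg_eq G Rel s t \<Longrightarrow> alg_eq G Rel t s"
| eq_trans: "alg_eq G Rel s t \<Longrightarrow> alg_eq G Rel t u \<Longrightarrow> alg_eq G Rel s u"
| eq_add_cong: "alg_eq G Rel s s' \<Longrightarrow> alg_eq G Rel t t' \<Longrightarrow> alg_eq G Rel (Add s t) (Add s' t')"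
| eq_mul_cong: "alg_eq G Rel s s' \<Longrightarrow> alg_eq G Rel t t' \<Longrightarrow> alg_eq G Rel (Mul s t) (Mul s' t')"
| eq_rel: "(s, t) \<in> Rel \<Longrightarrow> set_alg_term s \<subseteq> G \<Longrightarrow> set_alg_term t \<subseteq> G \<Longrightarrow> alg_eq G Rel s t"
| eq_add_assoc: "set_alg_term s \<subseteq> G \<Longrightarrow> set_alg_term t \<subseteq> G \<Longrightarrow> set_alg_term u \<subseteq> G \<Longrightarrow>
    alg_eq G Rel (Add (Add s t) u) (Add s (Add t u))"
| eq_add_comm: "set_alg_term s \<subseteq> G \<Longrightarrow> set_alg_term t \<subseteq> G \<Longrightarrow>
    alg_eq G Rel (Add s t) (Add t s)"
| eq_add_zero: "set_alg_term t \<subseteq> G \<Longrightarrow> alg_eq G Rel (Add (Cst 0) t) t"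
| eq_add_neg: "set_alg_term t \<subseteq> G \<Longrightarrow> alg_eq G Rel (Add (Mul (Cst (- 1)) t) t) (Cst 0)"
| eq_mul_assoc: "set_alg_term s \<subseteq> G \<Longrightarrow> set_alg_term t \<subseteq> G \<Longrightarrow> set_alg_term u \<subseteq> G \<Longrightarrow>
    alg_eq G Rel (Mul (Mul s t) u) (Mul s (Mul t u))"
| eq_mul_one_left: "set_alg_term t \<subseteq> G \<Longrightarrow> alg_eq G Rel (Mul (Cst 1) t) t"
| eq_mul_one_right: "set_alg_term t \<subseteq> G \<Longrightarrow> alg_eq G Rel (Mul t (Cst 1)) t"
| eq_distrib_left: "set_alg_term s \<subseteq> G \<Longrightarrow> set_alg_term t \<subseteq> G \<Longrightarrow> set_alg_term u \<subseteq> G \<Longrightarrow>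
    alg_eq G Rel (Mul s (Add t u)) (Add (Mul s t) (Mul s u))"
| eq_distrib_right: "set_alg_term s \<subseteq> G \<Longrightarrow> set_alg_term t \<subseteq> G \<Longrightarrow> set_alg_term u \<subseteq> G \<Longrightarrow>
    alg_eq G Rel (Mul (Add s t) u) (Add (Mul s u) (Mul t u))"
| eq_cst_add: "alg_eq G Rel (Cst (c + d)) (Add (Cst c) (Cst d))"
| eq_cst_mult: "alg_eq G Rel (Cst (c * d)) (Mul (Cst c) (Cst d))"
| eq_cst_central: "set_alg_term t \<subseteq> G \<Longrightarrow> alg_eq G Rel (Mul t (Cst c)) (Mul (Cst c) t)"

definition term_class ::
  "'g set \<Rightarrow> ('g alg_term \<times> 'g alg_term) set \<Rightarrow> 'g alg_term \<Rightarrow> 'g alg_term set" where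
  "term_class G Rel t = {s. alg_eq G Rel t s}"

definition presented ::
  "'g set \<Rightarrow> ('g alg_term \<times> 'g alg_term) set \<Rightarrow> (complex, 'g alg_term set) module" where
  "presented G Rel =
     \<lparr> carrier = term_class G Rel ` {t. set_alg_term t \<subseteq> G},
       monoid.mult = (\<lambda>X Y. \<Union>x \<in> X. \<Union>y \<in> Y. term_class G Rel (Mul x y)),
       one = term_class G Rel (Cst 1),
       zero = term_class G Rel (Cst 0),
       add = (\<lambda>X Y. \<Union>x \<in> X. \<Union>y \<in> Y. term_class G Rel (Add x y)),
       smult = (\<lambda>c X. \<Union>x \<in> X. term_class G Rel (Mul (Cst c) x)) \<rparr>"

section \<open>Universal localization\<close>

text \<open>The algebra generated by a copy \<open>Inl a\<close> of each \<open>a \<in> A\<close> and a formal inverse \<open>Inr s\<close>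
  of each \<open>s \<in> \<Sigma>\<close>. Its universal property is lemma \<open>localization_universal\<close> below.\<close>

definition loc_gens :: "(complex, 'a) module \<Rightarrow> 'a set \<Rightarrow> ('a + 'a) set" where
  "loc_gens A \<Sigma> = Inl ` carrier A \<union> Inr ` \<Sigma>"

definition loc_rels ::
  "(complex, 'a) module \<Rightarrow> 'a set \<Rightarrow> (('a + 'a) alg_term \<times> ('a + 'a) alg_term) set" where
  "loc_rels A \<Sigma> =
     {(Gen (Inl (a \<oplus>\<^bsub>A\<^esub> b)), Add (Gen (Inl a)) (Gen (Inl b))) | a b. a \<in> carrier A \<and> b \<in> carrier A} \<union>
     {(Gen (Inl (a \<otimes>\<^bsub>A\<^esub> b)), Mul (Gen (Inl a)) (Gen (Inl b))) | a b. a \<in> carrier A \<and> b \<in> carrier A} \<union>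
     {(Gen (Inl (c \<odot>\<^bsub>A\<^esub> a)), Mul (Cst c) (Gen (Inl a))) | c a. a \<in> carrier A} \<union>
     {(Gen (Inl \<one>\<^bsub>A\<^esub>), Cst 1)} \<union>
     {(Mul (Gen (Inl s)) (Gen (Inr s)), Cst 1) | s. s \<in> \<Sigma>} \<union>
     {(Mul (Gen (Inr s)) (Gen (Inl s)), Cst 1) | s. s \<in> \<Sigma>}"

definition localization ::
  "(complex, 'a) module \<Rightarrow> 'a set \<Rightarrow> (complex, ('a + 'a) alg_term set) module" where
  "localization A \<Sigma> = presented (loc_gens A \<Sigma>) (loc_rels A \<Sigma>)"

definition loc_map ::
  "(complex, 'a) module \<Rightarrow> 'a set \<Rightarrow> 'a \<Rightarrow> ('a + 'a) alg_term set" where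
  "loc_map A \<Sigma> a = term_class (loc_gens A \<Sigma>) (loc_rels A \<Sigma>) (Gen (Inl a))"

section \<open>The algebra of the catenoid and its localization\<close>

datatype cat_gen = GU | GR | GRi | GW | GWi

definition cat_rels :: "real \<Rightarrow> (cat_gen alg_term \<times> cat_gen alg_term) set" where
  "cat_rels hb =
     (let U = Gen GU; R = Gen GR; Ri = Gen GRi; W = Gen GW; Wi = Gen GWi;
          q = Cst (exp (of_real hb)); qi = Cst (exp (- of_real hb));
          h = Cst (of_real hb); mh = Cst (- of_real hb)
      in {(Mul W Wi, Cst 1), (Mul Wi W, Cst 1), (Mul R Ri, Cst 1), (Mul Ri R, Cst 1),
          (Mul R U, Mul U R), (Mul Ri U, Mul U Ri),
          (Mul W R, Mul q (Mul R W)), (Mul W Ri, Mul qi (Mul Ri W)),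
          (Mul Wi R, Mul qi (Mul R Wi)), (Mul Wi Ri, Mul q (Mul Ri Wi)),
          (Mul W U, Add (Mul U W) (Mul h W)), (Mul Wi U, Add (Mul U Wi) (Mul mh Wi))})"

type_synonym cat_elem = "cat_gen alg_term set"
type_synonym cat_loc_elem = "(cat_elem + cat_elem) alg_term set"

definition Cat :: "real \<Rightarrow> (complex, cat_elem) module" where
  "Cat hb = presented UNIV (cat_rels hb)"

definition cat_elt :: "real \<Rightarrow> cat_gen \<Rightarrow> cat_elem" where
  "cat_elt hb g = term_class UNIV (cat_rels hb) (Gen g)"

definition Z_UR :: "real \<Rightarrow> cat_elem set" where
  "Z_UR hb = gen_subalg (Cat hb) {cat_elt hb GU, cat_elt hb GR, cat_elt hb GRi}"

definition smooth_fun :: "(real \<Rightarrow> complex) \<Rightarrow> bool" where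
  "smooth_fun f \<longleftrightarrow> (\<exists>F. F 0 = f \<and>
     (\<forall>(n::nat) x. (F n has_vector_derivative F (Suc n) x) (at x)))"

definition smooth_algebra :: "(complex, real \<Rightarrow> complex) module" where
  "smooth_algebra =
     \<lparr> carrier = {f. smooth_fun f},
       monoid.mult = (\<lambda>f g x. f x * g x),
       one = (\<lambda>x. 1),
       zero = (\<lambda>x. 0),
       add = (\<lambda>f g x. f x + g x),
       smult = (\<lambda>c f x. c * f x) \<rparr>"

text \<open>The definite descriptions in this section and the next denote: see
  \<open>is_cat_phi_cat_phi\<close>, \<open>is_cat_star_cat_star\<close>, \<open>is_del_u_del_u\<close> and \<open>is_del_v_del_v\<close> below.\<close>

definition is_cat_phi :: "real \<Rightarrow> (cat_elem \<Rightarrow> real \<Rightarrow> complex) \<Rightarrow> bool" where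
  "is_cat_phi hb \<phi> \<longleftrightarrow>
     \<phi> \<in> extensional (Z_UR hb) \<and>
     alg_hom ((Cat hb)\<lparr>carrier := Z_UR hb\<rparr>) smooth_algebra \<phi> \<and>
     \<phi> (cat_elt hb GU) = (\<lambda>u. of_real u) \<and>
     \<phi> (cat_elt hb GR) = (\<lambda>u. of_real (exp u)) \<and>
     \<phi> (cat_elt hb GRi) = (\<lambda>u. of_real (exp (- u)))"

definition cat_phi :: "real \<Rightarrow> cat_elem \<Rightarrow> real \<Rightarrow> complex" where
  "cat_phi hb = (THE \<phi>. is_cat_phi hb \<phi>)"

definition Z_plus :: "real \<Rightarrow> cat_elem set" where
  "Z_plus hb = {p \<in> Z_UR hb. \<forall>u. cmod (cat_phi hb p u) > 0}"

definition CatLoc :: "real \<Rightarrow> (complex, cat_loc_elem) module" where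
  "CatLoc hb = localization (Cat hb) (Z_plus hb)"

definition elt :: "real \<Rightarrow> cat_gen \<Rightarrow> cat_loc_elem" where
  "elt hb g = loc_map (Cat hb) (Z_plus hb) (cat_elt hb g)"

section \<open>Involution and derivations\<close>

definition is_cat_star :: "real \<Rightarrow> (cat_loc_elem \<Rightarrow> cat_loc_elem) \<Rightarrow> bool" where
  "is_cat_star hb s \<longleftrightarrow>
     s \<in> extensional (carrier (CatLoc hb)) \<and> is_involution (CatLoc hb) s \<and>
     s (elt hb GU) = elt hb GU \<and> s (elt hb GR) = elt hb GR \<and> s (elt hb GW) = elt hb GWi"

definition cat_star :: "real \<Rightarrow> cat_loc_elem \<Rightarrow> cat_loc_elem" where
  "cat_star hb = (THE s. is_cat_star hb s)"

definition is_del_u :: "real \<Rightarrow> (cat_loc_elem \<Rightarrow> cat_loc_elem) \<Rightarrow> bool" where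
  "is_del_u hb d \<longleftrightarrow>
     d \<in> extensional (carrier (CatLoc hb)) \<and> is_derivation (CatLoc hb) d \<and>
     d (elt hb GU) = \<one>\<^bsub>CatLoc hb\<^esub> \<and> d (elt hb GR) = elt hb GR \<and> d (elt hb GW) = \<zero>\<^bsub>CatLoc hb\<^esub>"

definition is_del_v :: "real \<Rightarrow> (cat_loc_elem \<Rightarrow> cat_loc_elem) \<Rightarrow> bool" where
  "is_del_v hb d \<longleftrightarrow>
     d \<in> extensional (carrier (CatLoc hb)) \<and> is_derivation (CatLoc hb) d \<and>
     d (elt hb GU) = \<zero>\<^bsub>CatLoc hb\<^esub> \<and> d (elt hb GR) = \<zero>\<^bsub>CatLoc hb\<^esub> \<and>
     d (elt hb GW) = \<i> \<odot>\<^bsub>CatLoc hb\<^esub> elt hb GW"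

definition del_u :: "real \<Rightarrow> cat_loc_elem \<Rightarrow> cat_loc_elem" where
  "del_u hb = (THE d. is_del_u hb d)"

definition del_v :: "real \<Rightarrow> cat_loc_elem \<Rightarrow> cat_loc_elem" where
  "del_v hb = (THE d. is_del_v hb d)"

definition der_add :: "real \<Rightarrow> (cat_loc_elem \<Rightarrow> cat_loc_elem) \<Rightarrow> (cat_loc_elem \<Rightarrow> cat_loc_elem) \<Rightarrow>
    cat_loc_elem \<Rightarrow> cat_loc_elem" where
  "der_add hb d d' = (\<lambda>x \<in> carrier (CatLoc hb). d x \<oplus>\<^bsub>CatLoc hb\<^esub> d' x)"

definition der_smult :: "real \<Rightarrow> complex \<Rightarrow> (cat_loc_elem \<Rightarrow> cat_loc_elem) \<Rightarrow>
    cat_loc_elem \<Rightarrow> cat_loc_elem" where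
  "der_smult hb c d = (\<lambda>x \<in> carrier (CatLoc hb). c \<odot>\<^bsub>CatLoc hb\<^esub> d x)"

definition lie_g :: "real \<Rightarrow> (cat_loc_elem \<Rightarrow> cat_loc_elem) set" where
  "lie_g hb = {der_add hb (der_smult hb a (del_u hb)) (der_smult hb b (del_v hb)) | a b. True}"

definition del :: "real \<Rightarrow> cat_loc_elem \<Rightarrow> cat_loc_elem" where
  "del hb = der_smult hb (1/2) (der_add hb (del_u hb) (der_smult hb (- \<i>) (del_v hb)))"

definition delbar :: "real \<Rightarrow> cat_loc_elem \<Rightarrow> cat_loc_elem" where
  "delbar hb = der_smult hb (1/2) (der_add hb (del_u hb) (der_smult hb \<i> (del_v hb)))"

section \<open>The module of vector fields\<close>

type_synonym cat_vec = "cat_loc_elem ^ 3"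

definition vadd :: "real \<Rightarrow> cat_vec \<Rightarrow> cat_vec \<Rightarrow> cat_vec" where
  "vadd hb X Y = (\<chi> i. X $ i \<oplus>\<^bsub>CatLoc hb\<^esub> Y $ i)"

definition vneg :: "real \<Rightarrow> cat_vec \<Rightarrow> cat_vec" where
  "vneg hb X = (\<chi> i. \<ominus>\<^bsub>CatLoc hb\<^esub> (X $ i))"

definition vdiff :: "real \<Rightarrow> cat_vec \<Rightarrow> cat_vec \<Rightarrow> cat_vec" where
  "vdiff hb X Y = (\<chi> i. X $ i \<ominus>\<^bsub>CatLoc hb\<^esub> Y $ i)"

definition vzero :: "real \<Rightarrow> cat_vec" where
  "vzero hb = (\<chi> i. \<zero>\<^bsub>CatLoc hb\<^esub>)"

definition vscale :: "real \<Rightarrow> complex \<Rightarrow> cat_vec \<Rightarrow> cat_vec" where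
  "vscale hb c X = (\<chi> i. c \<odot>\<^bsub>CatLoc hb\<^esub> (X $ i))"

definition vmul :: "real \<Rightarrow> cat_vec \<Rightarrow> cat_loc_elem \<Rightarrow> cat_vec" where
  "vmul hb X a = (\<chi> i. X $ i \<otimes>\<^bsub>CatLoc hb\<^esub> a)"

definition Phi1 :: "real \<Rightarrow> cat_loc_elem" where
  "Phi1 hb = of_real (1/2 * exp (hb / 2)) \<odot>\<^bsub>CatLoc hb\<^esub>
     (elt hb GR \<otimes>\<^bsub>CatLoc hb\<^esub> elt hb GW \<ominus>\<^bsub>CatLoc hb\<^esub> elt hb GRi \<otimes>\<^bsub>CatLoc hb\<^esub> elt hb GWi)"

definition Phi2 :: "real \<Rightarrow> cat_loc_elem" where
  "Phi2 hb = (- (\<i> / 2) * of_real (exp (hb / 2))) \<odot>\<^bsub>CatLoc hb\<^esub>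
     (elt hb GR \<otimes>\<^bsub>CatLoc hb\<^esub> elt hb GW \<oplus>\<^bsub>CatLoc hb\<^esub> elt hb GRi \<otimes>\<^bsub>CatLoc hb\<^esub> elt hb GWi)"

definition Phi3 :: "real \<Rightarrow> cat_loc_elem" where
  "Phi3 hb = \<one>\<^bsub>CatLoc hb\<^esub>"

definition Phi :: "real \<Rightarrow> cat_vec" where
  "Phi hb = (\<chi> i. if i = 1 then Phi1 hb else if i = 2 then Phi2 hb else Phi3 hb)"

definition Phibar :: "real \<Rightarrow> cat_vec" where
  "Phibar hb = (\<chi> i. cat_star hb (Phi hb $ i))"

definition VF :: "real \<Rightarrow> cat_vec set" where
  "VF hb = {vadd hb (vmul hb (Phi hb) a) (vmul hb (Phibar hb) b) | a b.
     a \<in> carrier (CatLoc hb) \<and> b \<in> carrier (CatLoc hb)}"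

definition hermitian_form :: "real \<Rightarrow> (cat_vec \<Rightarrow> cat_vec \<Rightarrow> cat_loc_elem) \<Rightarrow> bool" where
  "hermitian_form hb h \<longleftrightarrow>
     (\<forall>X \<in> VF hb. \<forall>Y \<in> VF hb. h X Y \<in> carrier (CatLoc hb)) \<and>
     (\<forall>X \<in> VF hb. \<forall>Y \<in> VF hb. \<forall>Z \<in> VF hb. h X (vadd hb Y Z) = h X Y \<oplus>\<^bsub>CatLoc hb\<^esub> h X Z) \<and>
     (\<forall>X \<in> VF hb. \<forall>Y \<in> VF hb. cat_star hb (h X Y) = h Y X) \<and>
     (\<forall>X \<in> VF hb. \<forall>Y \<in> VF hb. \<forall>a \<in> carrier (CatLoc hb). h X (vmul hb Y a) = h X Y \<otimes>\<^bsub>CatLoc hb\<^esub> a)"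

definition connection ::
  "real \<Rightarrow> ((cat_loc_elem \<Rightarrow> cat_loc_elem) \<Rightarrow> cat_vec \<Rightarrow> cat_vec) \<Rightarrow> bool" where
  "connection hb nabla \<longleftrightarrow>
     (\<forall>d \<in> lie_g hb. \<forall>X \<in> VF hb. nabla d X \<in> VF hb) \<and>
     (\<forall>d \<in> lie_g hb. \<forall>d' \<in> lie_g hb. \<forall>X \<in> VF hb.
        nabla (der_add hb d d') X = vadd hb (nabla d X) (nabla d' X)) \<and>
     (\<forall>c. \<forall>d \<in> lie_g hb. \<forall>X \<in> VF hb. nabla (der_smult hb c d) X = vscale hb c (nabla d X)) \<and>
     (\<forall>d \<in> lie_g hb. \<forall>X \<in> VF hb. \<forall>Y \<in> VF hb.
        nabla d (vadd hb X Y) = vadd hb (nabla d X) (nabla d Y)) \<and>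
     (\<forall>c. \<forall>d \<in> lie_g hb. \<forall>X \<in> VF hb. nabla d (vscale hb c X) = vscale hb c (nabla d X)) \<and>
     (\<forall>d \<in> lie_g hb. \<forall>X \<in> VF hb. \<forall>a \<in> carrier (CatLoc hb).
        nabla d (vmul hb X a) = vadd hb (vmul hb (nabla d X) a) (vmul hb X (d a)))"

text \<open>The term involving \<open>\<nabla>\<close> at \<open>[d, d']\<close> is absent because \<open>lie_g hb\<close> is abelian.\<close>

definition curvature ::
  "real \<Rightarrow> ((cat_loc_elem \<Rightarrow> cat_loc_elem) \<Rightarrow> cat_vec \<Rightarrow> cat_vec) \<Rightarrow>
    (cat_loc_elem \<Rightarrow> cat_loc_elem) \<Rightarrow> (cat_loc_elem \<Rightarrow> cat_loc_elem) \<Rightarrow> cat_vec \<Rightarrow> cat_vec" where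
  "curvature hb nabla d d' X = vdiff hb (nabla d (nabla d' X)) (nabla d' (nabla d X))"

section \<open>Algebras with presentations\<close>

context cx_algebra
begin

lemma smult_zero_scalar: "x \<in> carrier A \<Longrightarrow> 0 \<odot> x = \<zero>"
  using smult_l_distr[of x 0 0] smult_closed[of x 0] by simp

lemma smult_zero: "c \<odot> \<zero> = \<zero>"
  using smult_r_distr[of \<zero> \<zero> c] smult_closed[of \<zero> c] by simp

lemma smult_minus_one: "x \<in> carrier A \<Longrightarrow> (- 1) \<odot> x = \<ominus> x"
  using smult_l_distr[of x "-1" 1] smult_one[of x] smult_zero_scalar[of x] smult_closed[of x "-1"]
  by (simp add: minus_equality)

end

lemma alg_homD:
  assumes "alg_hom A B f"
  shows "x \<in> carrier A \<Longrightarrow> f x \<in> carrier B"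
    and "x \<in> carrier A \<Longrightarrow> y \<in> carrier A \<Longrightarrow> f (x \<oplus>\<^bsub>A\<^esub> y) = f x \<oplus>\<^bsub>B\<^esub> f y"
    and "x \<in> carrier A \<Longrightarrow> y \<in> carrier A \<Longrightarrow> f (x \<otimes>\<^bsub>A\<^esub> y) = f x \<otimes>\<^bsub>B\<^esub> f y"
    and "x \<in> carrier A \<Longrightarrow> f (c \<odot>\<^bsub>A\<^esub> x) = c \<odot>\<^bsub>B\<^esub> f x"
    and "f \<one>\<^bsub>A\<^esub> = \<one>\<^bsub>B\<^esub>"
  using assms by (auto simp: alg_hom_def)

lemma alg_hom_comp:
  assumes "alg_hom A B f" "alg_hom B C g"
  shows "alg_hom A C (\<lambda>x. g (f x))"
  using assms by (auto simp: alg_hom_def)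

lemma alg_hom_zero:
  assumes "cx_algebra A" "cx_algebra B" "alg_hom A B f"
  shows "f \<zero>\<^bsub>A\<^esub> = \<zero>\<^bsub>B\<^esub>"
proof -
  interpret A: cx_algebra A by fact
  interpret B: cx_algebra B by fact
  have "f (0 \<odot>\<^bsub>A\<^esub> \<zero>\<^bsub>A\<^esub>) = 0 \<odot>\<^bsub>B\<^esub> f \<zero>\<^bsub>A\<^esub>"
    using alg_homD(4)[OF assms(3)] by simp
  then show ?thesis
    using A.smult_zero B.smult_zero_scalar alg_homD(1)[OF assms(3)] by simp
qed

lemma alg_hom_Units:
  assumes "cx_algebra A" "cx_algebra B" "alg_hom A B f" "x \<in> Units A"
  shows "f x \<in> Units B" "f (inv\<^bsub>A\<^esub> x) = inv\<^bsub>B\<^esub> (f x)"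
proof -
  interpret A: cx_algebra A by fact
  interpret B: cx_algebra B by fact
  note h = alg_homD[OF assms(3)]
  have x: "x \<in> carrier A" "inv\<^bsub>A\<^esub> x \<in> carrier A" using assms(4) by auto
  have 1: "f x \<otimes>\<^bsub>B\<^esub> f (inv\<^bsub>A\<^esub> x) = \<one>\<^bsub>B\<^esub>" "f (inv\<^bsub>A\<^esub> x) \<otimes>\<^bsub>B\<^esub> f x = \<one>\<^bsub>B\<^esub>"
    using h(3)[OF x] h(3)[OF x(2,1)] h(5) assms(4) by auto
  then show "f x \<in> Units B" unfolding Units_def using h(1) x by blast
  show "f (inv\<^bsub>A\<^esub> x) = inv\<^bsub>B\<^esub> (f x)"
    by (metis 1 B.inv_unique' h(1) x)
qed

lemma alg_eq_wf:
  "alg_eq G Rel s t \<Longrightarrow> set_alg_term s \<subseteq> G \<and> set_alg_term t \<subseteq> G"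
  by (induction rule: alg_eq.induct) simp_all

lemma term_class_eq:
  assumes "set_alg_term s \<subseteq> G"
  shows "term_class G Rel s = term_class G Rel t \<longleftrightarrow> alg_eq G Rel s t"
proof
  assume "term_class G Rel s = term_class G Rel t"
  moreover have "s \<in> term_class G Rel s" using assms by (simp add: term_class_def alg_eq.eq_refl)
  ultimately have "alg_eq G Rel t s" by (simp add: term_class_def)
  then show "alg_eq G Rel s t" by (rule alg_eq.eq_sym)
next
  assume st: "alg_eq G Rel s t"
  have "alg_eq G Rel s u \<longleftrightarrow> alg_eq G Rel t u" for u
    using alg_eq.eq_trans[OF alg_eq.eq_sym[OF st], of u] alg_eq.eq_trans[OF st, of u] by (rule iffI)
  then show "term_class G Rel s = term_class G Rel t" by (simp add: term_class_def)
qed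

lemma term_class_eqI: "alg_eq G Rel s t \<Longrightarrow> term_class G Rel s = term_class G Rel t"
  using term_class_eq[of s G Rel t] alg_eq_wf[of G Rel s t] by simp

lemma presented_carrier:
  "X \<in> carrier (presented G Rel) \<longleftrightarrow> (\<exists>t. set_alg_term t \<subseteq> G \<and> X = term_class G Rel t)"
  by (auto simp: presented_def)

lemma presented_ops:
  assumes s: "set_alg_term s \<subseteq> G" and t: "set_alg_term t \<subseteq> G"
  shows "term_class G Rel s \<otimes>\<^bsub>presented G Rel\<^esub> term_class G Rel t = term_class G Rel (Mul s t)"
    and "term_class G Rel s \<oplus>\<^bsub>presented G Rel\<^esub> term_class G Rel t = term_class G Rel (Add s t)"
    and "c \<odot>\<^bsub>presented G Rel\<^esub> term_class G Rel t = term_class G Rel (Mul (Cst c) t)"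
proof -
  have in_cls: "s \<in> term_class G Rel s" "t \<in> term_class G Rel t"
    using s t by (simp_all add: term_class_def alg_eq.eq_refl)
  have "term_class G Rel (Mul x y) = term_class G Rel (Mul s t)"
    "term_class G Rel (Add x y) = term_class G Rel (Add s t)"
    if "x \<in> term_class G Rel s" "y \<in> term_class G Rel t" for x y
  proof -
    have st: "alg_eq G Rel s x" "alg_eq G Rel t y" using that by (simp_all add: term_class_def)
    show "term_class G Rel (Mul x y) = term_class G Rel (Mul s t)"
      by (rule term_class_eqI[OF alg_eq.eq_sym[OF alg_eq.eq_mul_cong[OF st]]])
    show "term_class G Rel (Add x y) = term_class G Rel (Add s t)"
      by (rule term_class_eqI[OF alg_eq.eq_sym[OF alg_eq.eq_add_cong[OF st]]])
  qed
  moreover have "term_class G Rel (Mul (Cst c) y) = term_class G Rel (Mul (Cst c) t)"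
    if "y \<in> term_class G Rel t" for y
  proof -
    have y: "alg_eq G Rel t y" using that by (simp add: term_class_def)
    have c: "alg_eq G Rel (Cst c) (Cst c)" by (rule alg_eq.eq_refl) simp
    show ?thesis by (rule term_class_eqI[OF alg_eq.eq_sym[OF alg_eq.eq_mul_cong[OF c y]]])
  qed
  moreover have UN: "(\<Union>x \<in> X. F x) = D" if "a \<in> X" "\<And>x. x \<in> X \<Longrightarrow> F x = D"
    for a and X :: "'a alg_term set" and D :: "'a alg_term set" and F
    using that by blast
  ultimately show "term_class G Rel s \<otimes>\<^bsub>presented G Rel\<^esub> term_class G Rel t = term_class G Rel (Mul s t)"
    "term_class G Rel s \<oplus>\<^bsub>presented G Rel\<^esub> term_class G Rel t = term_class G Rel (Add s t)"
    "c \<odot>\<^bsub>presented G Rel\<^esub> term_class G Rel t = term_class G Rel (Mul (Cst c) t)"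
    unfolding presented_def ring.simps monoid.simps module.simps
    by (intro UN[OF in_cls(1)] UN[OF in_cls(2)]; simp)+
qed

lemmas presented_smult = presented_ops(3)[where s = "Cst 0", simplified]

lemma presented_consts:
  "\<one>\<^bsub>presented G Rel\<^esub> = term_class G Rel (Cst 1)"
  "\<zero>\<^bsub>presented G Rel\<^esub> = term_class G Rel (Cst 0)"
  by (auto simp: presented_def)

lemma presented_cx_algebra: "cx_algebra (presented G Rel)"
proof -
  let ?A = "presented G Rel" and ?c = "term_class G Rel"
  note car = presented_carrier and ops = presented_ops presented_smult presented_consts
  have cl: "?c t \<in> carrier ?A" if "set_alg_term t \<subseteq> G" for t
    using that by (auto simp: car)
  have rep: "\<exists>t. set_alg_term t \<subseteq> G \<and> X = ?c t" if "X \<in> carrier ?A" for X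
    using that by (auto simp: car)
  note eqs = alg_eq.intros(7-)[THEN term_class_eqI]
  have ag: "abelian_group ?A"
  proof (rule abelian_groupI)
    fix x y z assume "x \<in> carrier ?A" "y \<in> carrier ?A" "z \<in> carrier ?A"
    then obtain s t u where "set_alg_term s \<subseteq> G" "set_alg_term t \<subseteq> G" "set_alg_term u \<subseteq> G"
      "x = ?c s" "y = ?c t" "z = ?c u" by (auto simp: car)
    then show "x \<oplus>\<^bsub>?A\<^esub> y \<oplus>\<^bsub>?A\<^esub> z = x \<oplus>\<^bsub>?A\<^esub> (y \<oplus>\<^bsub>?A\<^esub> z)"
      by (simp add: ops eqs(1))
  next
    fix x y assume "x \<in> carrier ?A" "y \<in> carrier ?A"
    then obtain s t where "set_alg_term s \<subseteq> G" "set_alg_term t \<subseteq> G"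
      "x = ?c s" "y = ?c t" by (auto simp: car)
    then show "x \<oplus>\<^bsub>?A\<^esub> y \<in> carrier ?A" "x \<oplus>\<^bsub>?A\<^esub> y = y \<oplus>\<^bsub>?A\<^esub> x"
      by (auto simp: ops cl eqs(2))
  next
    show "\<zero>\<^bsub>?A\<^esub> \<in> carrier ?A" by (simp add: ops cl)
  next
    fix x assume "x \<in> carrier ?A"
    then obtain t where t: "set_alg_term t \<subseteq> G" "x = ?c t" by (auto simp: car)
    then show "\<zero>\<^bsub>?A\<^esub> \<oplus>\<^bsub>?A\<^esub> x = x" by (simp add: ops eqs(3))
    show "\<exists>y\<in>carrier ?A. y \<oplus>\<^bsub>?A\<^esub> x = \<zero>\<^bsub>?A\<^esub>"
      using t by (intro bexI[of _ "?c (Mul (Cst (-1)) t)"]) (auto simp: ops cl eqs(4))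
  qed
  have mo: "Group.monoid ?A"
  proof (rule monoidI)
    fix x y z assume "x \<in> carrier ?A" "y \<in> carrier ?A" "z \<in> carrier ?A"
    then obtain s t u where "set_alg_term s \<subseteq> G" "set_alg_term t \<subseteq> G" "set_alg_term u \<subseteq> G"
      "x = ?c s" "y = ?c t" "z = ?c u" by (auto simp: car)
    then show "x \<otimes>\<^bsub>?A\<^esub> y \<otimes>\<^bsub>?A\<^esub> z = x \<otimes>\<^bsub>?A\<^esub> (y \<otimes>\<^bsub>?A\<^esub> z)"
      by (simp add: ops eqs(5))
  next
    fix x y assume "x \<in> carrier ?A" "y \<in> carrier ?A"
    then obtain s t where "set_alg_term s \<subseteq> G" "set_alg_term t \<subseteq> G"
      "x = ?c s" "y = ?c t" by (auto simp: car)
    then show "x \<otimes>\<^bsub>?A\<^esub> y \<in> carrier ?A" by (auto simp: ops cl)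
  next
    show "\<one>\<^bsub>?A\<^esub> \<in> carrier ?A" by (simp add: ops cl)
  next
    fix x assume "x \<in> carrier ?A"
    then obtain t where t: "set_alg_term t \<subseteq> G" "x = ?c t" by (auto simp: car)
    then show "\<one>\<^bsub>?A\<^esub> \<otimes>\<^bsub>?A\<^esub> x = x" "x \<otimes>\<^bsub>?A\<^esub> \<one>\<^bsub>?A\<^esub> = x" by (simp_all add: ops eqs(6,7))
  qed
  interpret r: ring ?A
  proof (rule ringI[OF ag mo])
    fix x y z assume "x \<in> carrier ?A" "y \<in> carrier ?A" "z \<in> carrier ?A"
    then obtain s t u where "set_alg_term s \<subseteq> G" "set_alg_term t \<subseteq> G" "set_alg_term u \<subseteq> G"
      "x = ?c s" "y = ?c t" "z = ?c u" by (auto simp: car)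
    then show "(x \<oplus>\<^bsub>?A\<^esub> y) \<otimes>\<^bsub>?A\<^esub> z = x \<otimes>\<^bsub>?A\<^esub> z \<oplus>\<^bsub>?A\<^esub> y \<otimes>\<^bsub>?A\<^esub> z"
      "z \<otimes>\<^bsub>?A\<^esub> (x \<oplus>\<^bsub>?A\<^esub> y) = z \<otimes>\<^bsub>?A\<^esub> x \<oplus>\<^bsub>?A\<^esub> z \<otimes>\<^bsub>?A\<^esub> y"
      by (simp_all add: ops eqs(8,9))
  qed
  define k where "k c = ?c (Cst c)" for c
  have k: "k c \<in> carrier ?A" for c by (simp add: k_def cl)
  have sm: "c \<odot>\<^bsub>?A\<^esub> x = k c \<otimes>\<^bsub>?A\<^esub> x" if x: "x \<in> carrier ?A" for c x
  proof -
    obtain t where "set_alg_term t \<subseteq> G" "x = ?c t" using rep[OF x] by auto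
    then show ?thesis by (simp add: ops k_def)
  qed
  have k_add: "k (c + d) = k c \<oplus>\<^bsub>?A\<^esub> k d" and k_mult: "k (c * d) = k c \<otimes>\<^bsub>?A\<^esub> k d" for c d
    by (simp_all add: k_def ops eqs(10,11))
  have k_comm: "x \<otimes>\<^bsub>?A\<^esub> k c = k c \<otimes>\<^bsub>?A\<^esub> x" if x: "x \<in> carrier ?A" for x c
  proof -
    obtain t where "set_alg_term t \<subseteq> G" "x = ?c t" using rep[OF x] by auto
    then show ?thesis by (simp add: ops k_def eqs(12))
  qed
  have k1: "k 1 = \<one>\<^bsub>?A\<^esub>" by (simp add: k_def ops)
  show ?thesis
  proof
    fix x y c assume xy: "x \<in> carrier ?A" "y \<in> carrier ?A"
    have "x \<otimes>\<^bsub>?A\<^esub> (c \<odot>\<^bsub>?A\<^esub> y) = (x \<otimes>\<^bsub>?A\<^esub> k c) \<otimes>\<^bsub>?A\<^esub> y"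
      using xy by (simp add: sm k r.m_assoc)
    also have "\<dots> = (k c \<otimes>\<^bsub>?A\<^esub> x) \<otimes>\<^bsub>?A\<^esub> y"
      using xy by (simp only: k_comm)
    also have "\<dots> = c \<odot>\<^bsub>?A\<^esub> (x \<otimes>\<^bsub>?A\<^esub> y)"
      using xy by (simp add: sm k r.m_assoc)
    finally show "x \<otimes>\<^bsub>?A\<^esub> (c \<odot>\<^bsub>?A\<^esub> y) = c \<odot>\<^bsub>?A\<^esub> (x \<otimes>\<^bsub>?A\<^esub> y)" .
  qed (simp_all add: sm k k_add k_mult r.l_distr r.r_distr r.m_assoc k1)
qed

fun term_eval :: "(complex, 'b) module \<Rightarrow> ('g \<Rightarrow> 'b) \<Rightarrow> 'g alg_term \<Rightarrow> 'b" where
  "term_eval B f (Gen g) = f g"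
| "term_eval B f (Cst c) = c \<odot>\<^bsub>B\<^esub> \<one>\<^bsub>B\<^esub>"
| "term_eval B f (Add s t) = term_eval B f s \<oplus>\<^bsub>B\<^esub> term_eval B f t"
| "term_eval B f (Mul s t) = term_eval B f s \<otimes>\<^bsub>B\<^esub> term_eval B f t"

lemma term_eval_closed:
  assumes "cx_algebra B" "\<And>g. g \<in> G \<Longrightarrow> f g \<in> carrier B" "set_alg_term t \<subseteq> G"
  shows "term_eval B f t \<in> carrier B"
proof -
  interpret B: cx_algebra B by fact
  show ?thesis using assms(3) by (induction t) (auto simp: assms(2) B.smult_closed)
qed

lemma term_eval_alg_eq:
  assumes B: "cx_algebra B" and f: "\<And>g. g \<in> G \<Longrightarrow> f g \<in> carrier B"
    and rel: "\<And>s t. (s, t) \<in> Rel \<Longrightarrow> term_eval B f s = term_eval B f t"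
    and eq: "alg_eq G Rel s t"
  shows "term_eval B f s = term_eval B f t"
proof -
  interpret B: cx_algebra B by fact
  note cl = term_eval_closed[OF B f]
  note sm = B.smult_mult_l B.smult_mult_r B.smult_closed B.smult_one
  show ?thesis using eq
  proof (induction rule: alg_eq.induct)
    case (eq_rel s t) then show ?case by (simp add: assms(3))
  next
    case (eq_add_neg t)
    then show ?case by (simp add: cl sm B.smult_minus_one B.l_minus B.l_neg B.smult_zero_scalar)
  next
    case (eq_cst_mult c d)
    have "c \<odot>\<^bsub>B\<^esub> (d \<odot>\<^bsub>B\<^esub> \<one>\<^bsub>B\<^esub>) = d \<odot>\<^bsub>B\<^esub> (c \<odot>\<^bsub>B\<^esub> \<one>\<^bsub>B\<^esub>)"
      by (metis B.one_closed B.smult_smult mult.commute)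
    then show ?case by (simp add: sm B.smult_smult)
  qed (auto simp: cl sm B.smult_l_distr B.smult_smult B.smult_zero_scalar B.a_ac B.m_assoc
      B.l_distr B.r_distr)
qed

lemma presented_universal:
  assumes B: "cx_algebra B" and f: "\<And>g. g \<in> G \<Longrightarrow> f g \<in> carrier B"
    and rel: "\<And>s t. (s, t) \<in> Rel \<Longrightarrow> term_eval B f s = term_eval B f t"
  shows "\<exists>F. alg_hom (presented G Rel) B F \<and> (\<forall>g \<in> G. F (term_class G Rel (Gen g)) = f g)"
proof -
  interpret B: cx_algebra B by fact
  define F where "F X = term_eval B f (SOME t. t \<in> X)" for X
  have F: "F (term_class G Rel t) = term_eval B f t" if "set_alg_term t \<subseteq> G" for t
  proof -
    have "t \<in> term_class G Rel t" using that by (simp add: term_class_def alg_eq.eq_refl)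
    then have "(SOME s. s \<in> term_class G Rel t) \<in> term_class G Rel t" by (rule someI)
    then have "alg_eq G Rel t (SOME s. s \<in> term_class G Rel t)" by (simp add: term_class_def)
    then show ?thesis unfolding F_def using term_eval_alg_eq[OF B f rel] by metis
  qed
  note cl = term_eval_closed[OF B f]
  have "alg_hom (presented G Rel) B F"
    unfolding alg_hom_def
    by (auto simp: presented_carrier presented_ops presented_smult presented_consts F cl B.smult_one B.smult_mult_l
        B.smult_closed)
  then show ?thesis using F by (intro exI[of _ F]) auto
qed

lemma presented_hom_unique:
  assumes B: "cx_algebra B"
    and F: "alg_hom (presented G Rel) B F" and F': "alg_hom (presented G Rel) B F'"
    and eq: "\<And>g. g \<in> G \<Longrightarrow> F (term_class G Rel (Gen g)) = F' (term_class G Rel (Gen g))"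
    and X: "X \<in> carrier (presented G Rel)"
  shows "F X = F' X"
proof -
  interpret P: cx_algebra "presented G Rel" by (rule presented_cx_algebra)
  have cl: "term_class G Rel t \<in> carrier (presented G Rel)" if "set_alg_term t \<subseteq> G" for t
    using that by (auto simp: presented_carrier)
  have "F (term_class G Rel t) = F' (term_class G Rel t)" if "set_alg_term t \<subseteq> G" for t
    using that
  proof (induction t)
    case (Gen g) then show ?case by (simp add: eq)
  next
    case (Cst c)
    have "alg_eq G Rel (Mul (Cst c) (Cst 1)) (Cst c)" by (rule alg_eq.eq_mul_one_right) simp
    then have "term_class G Rel (Mul (Cst c) (Cst 1)) = term_class G Rel (Cst c)"
      by (rule term_class_eqI)
    then have "term_class G Rel (Cst c) = c \<odot>\<^bsub>presented G Rel\<^esub> \<one>\<^bsub>presented G Rel\<^esub>"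
      by (simp add: presented_consts presented_ops presented_smult)
    then show ?case
      using alg_homD(4,5)[OF F] alg_homD(4,5)[OF F'] by simp
  next
    case (Add s t)
    then show ?case
      using alg_homD(2)[OF F] alg_homD(2)[OF F'] cl by (simp add: presented_ops(2)[symmetric])
  next
    case (Mul s t)
    then show ?case
      using alg_homD(3)[OF F] alg_homD(3)[OF F'] cl by (simp add: presented_ops(1)[symmetric])
  qed
  then show ?thesis using X by (auto simp: presented_carrier)
qed

section \<open>The universal property of the localization\<close>

lemma localization_cx_algebra: "cx_algebra (localization A \<Sigma>)"
  by (simp add: localization_def presented_cx_algebra)

lemma loc_map_hom:
  assumes A: "cx_algebra A"
  shows "alg_hom A (localization A \<Sigma>) (loc_map A \<Sigma>)"
proof -
  interpret A: cx_algebra A by fact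
  let ?G = "loc_gens A \<Sigma>" and ?R = "loc_rels A \<Sigma>"
  have G: "Inl a \<in> ?G" if "a \<in> carrier A" for a using that by (simp add: loc_gens_def)
  have Rel: "term_class ?G ?R s = term_class ?G ?R t"
    if "(s, t) \<in> ?R" "set_alg_term s \<subseteq> ?G" "set_alg_term t \<subseteq> ?G" for s t
    using that by (intro term_class_eqI alg_eq.eq_rel)
  have "term_class ?G ?R (Gen (Inl (a \<oplus>\<^bsub>A\<^esub> b))) = term_class ?G ?R (Add (Gen (Inl a)) (Gen (Inl b)))"
    "term_class ?G ?R (Gen (Inl (a \<otimes>\<^bsub>A\<^esub> b))) = term_class ?G ?R (Mul (Gen (Inl a)) (Gen (Inl b)))"
    "term_class ?G ?R (Gen (Inl (c \<odot>\<^bsub>A\<^esub> a))) = term_class ?G ?R (Mul (Cst c) (Gen (Inl a)))"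
    if "a \<in> carrier A" "b \<in> carrier A" for a b c
  proof -
    have "(Gen (Inl (a \<oplus>\<^bsub>A\<^esub> b)), Add (Gen (Inl a)) (Gen (Inl b))) \<in> ?R"
      "(Gen (Inl (a \<otimes>\<^bsub>A\<^esub> b)), Mul (Gen (Inl a)) (Gen (Inl b))) \<in> ?R"
      "(Gen (Inl (c \<odot>\<^bsub>A\<^esub> a)), Mul (Cst c) (Gen (Inl a))) \<in> ?R"
      using that unfolding loc_rels_def by blast+
    then show "term_class ?G ?R (Gen (Inl (a \<oplus>\<^bsub>A\<^esub> b))) = term_class ?G ?R (Add (Gen (Inl a)) (Gen (Inl b)))"
      "term_class ?G ?R (Gen (Inl (a \<otimes>\<^bsub>A\<^esub> b))) = term_class ?G ?R (Mul (Gen (Inl a)) (Gen (Inl b)))"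
      "term_class ?G ?R (Gen (Inl (c \<odot>\<^bsub>A\<^esub> a))) = term_class ?G ?R (Mul (Cst c) (Gen (Inl a)))"
      using that by (simp_all add: Rel G A.smult_closed)
  qed
  moreover have "term_class ?G ?R (Gen (Inl \<one>\<^bsub>A\<^esub>)) = term_class ?G ?R (Cst 1)"
    by (rule Rel) (auto simp: loc_rels_def G)
  moreover have "term_class ?G ?R (Gen (Inl a)) \<in> carrier (presented ?G ?R)" if "a \<in> carrier A" for a
    using that G by (auto simp: presented_carrier intro!: exI[of _ "Gen (Inl a)"])
  ultimately show ?thesis
    unfolding alg_hom_def loc_map_def localization_def
    by (auto simp: presented_ops presented_smult presented_consts G)
qed

lemma loc_map_Units:
  assumes "\<Sigma> \<subseteq> carrier A" "s \<in> \<Sigma>"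
  shows "loc_map A \<Sigma> s \<in> Units (localization A \<Sigma>)"
    and "inv\<^bsub>localization A \<Sigma>\<^esub> (loc_map A \<Sigma> s) =
      term_class (loc_gens A \<Sigma>) (loc_rels A \<Sigma>) (Gen (Inr s))"
proof -
  let ?G = "loc_gens A \<Sigma>" and ?R = "loc_rels A \<Sigma>" and ?L = "localization A \<Sigma>"
  interpret L: cx_algebra ?L by (rule localization_cx_algebra)
  let ?a = "loc_map A \<Sigma> s" and ?b = "term_class ?G ?R (Gen (Inr s))"
  have G: "Inl s \<in> ?G" "Inr s \<in> ?G" using assms by (auto simp: loc_gens_def)
  then have cl: "?a \<in> carrier ?L" "?b \<in> carrier ?L"
    unfolding localization_def loc_map_def presented_carrier
    by - (rule exI[of _ "Gen (Inl s)"], simp, rule exI[of _ "Gen (Inr s)"], simp)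
  have "alg_eq ?G ?R (Mul (Gen (Inl s)) (Gen (Inr s))) (Cst 1)"
    "alg_eq ?G ?R (Mul (Gen (Inr s)) (Gen (Inl s))) (Cst 1)"
    using G assms by (auto intro!: alg_eq.eq_rel simp: loc_rels_def)
  then have 1: "?a \<otimes>\<^bsub>?L\<^esub> ?b = \<one>\<^bsub>?L\<^esub>" "?b \<otimes>\<^bsub>?L\<^esub> ?a = \<one>\<^bsub>?L\<^esub>"
    using G by (simp_all add: localization_def loc_map_def presented_ops presented_smult presented_consts
      term_class_eq)
  then show "?a \<in> Units ?L" using cl by (auto simp: Units_def)
  show "inv\<^bsub>?L\<^esub> ?a = ?b" using L.inv_unique'[OF cl 1] by simp
qed

lemma localization_universal:
  assumes A: "cx_algebra A" and B: "cx_algebra B" and \<Sigma>: "\<Sigma> \<subseteq> carrier A"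
    and F: "alg_hom A B F" and U: "\<And>s. s \<in> \<Sigma> \<Longrightarrow> F s \<in> Units B"
  shows "\<exists>H. alg_hom (localization A \<Sigma>) B H \<and> (\<forall>a \<in> carrier A. H (loc_map A \<Sigma> a) = F a)"
proof -
  interpret A: cx_algebra A by fact
  interpret B: cx_algebra B by fact
  note F' = alg_homD[OF F]
  let ?f = "case_sum F (\<lambda>s. inv\<^bsub>B\<^esub> (F s))"
  have "\<exists>H. alg_hom (presented (loc_gens A \<Sigma>) (loc_rels A \<Sigma>)) B H \<and>
    (\<forall>g \<in> loc_gens A \<Sigma>. H (term_class (loc_gens A \<Sigma>) (loc_rels A \<Sigma>) (Gen g)) = ?f g)"
  proof (rule presented_universal[OF B])
    show "?f g \<in> carrier B" if "g \<in> loc_gens A \<Sigma>" for g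
      using that F' U by (auto simp: loc_gens_def)
    show "term_eval B ?f s = term_eval B ?f t" if "(s, t) \<in> loc_rels A \<Sigma>" for s t
      using that F' U by (auto simp: loc_rels_def B.smult_one B.smult_mult_l)
  qed
  then show ?thesis by (auto simp: localization_def loc_map_def loc_gens_def)
qed

lemma localization_hom_unique:
  assumes A: "cx_algebra A" and B: "cx_algebra B" and \<Sigma>: "\<Sigma> \<subseteq> carrier A"
    and F: "alg_hom (localization A \<Sigma>) B F" and F': "alg_hom (localization A \<Sigma>) B F'"
    and eq: "\<And>a. a \<in> carrier A \<Longrightarrow> F (loc_map A \<Sigma> a) = F' (loc_map A \<Sigma> a)"
    and X: "X \<in> carrier (localization A \<Sigma>)"
  shows "F X = F' X"
proof (rule presented_hom_unique[OF B F[unfolded localization_def] F'[unfolded localization_def]])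
  show "X \<in> carrier (presented (loc_gens A \<Sigma>) (loc_rels A \<Sigma>))"
    using X by (simp add: localization_def)
  fix g assume "g \<in> loc_gens A \<Sigma>"
  then consider a where "g = Inl a" "a \<in> carrier A" | s where "g = Inr s" "s \<in> \<Sigma>"
    by (auto simp: loc_gens_def)
  then show "F (term_class (loc_gens A \<Sigma>) (loc_rels A \<Sigma>) (Gen g)) =
    F' (term_class (loc_gens A \<Sigma>) (loc_rels A \<Sigma>) (Gen g))"
  proof cases
    case 1 then show ?thesis using eq by (simp add: loc_map_def)
  next
    case 2
    note u = loc_map_Units[OF \<Sigma> 2(2)]
    show ?thesis
      using alg_hom_Units(2)[OF localization_cx_algebra B F u(1)]
        alg_hom_Units(2)[OF localization_cx_algebra B F' u(1)] eq[of s] 2 \<Sigma>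
      by (auto simp: u(2))
  qed
qed

section \<open>Smooth functions\<close>

lemma smooth_fun_const: "smooth_fun (\<lambda>x. c)"
  unfolding smooth_fun_def
  by (rule exI[of _ "\<lambda>n x. if n = 0 then c else 0"]) auto

lemma smooth_fun_ident: "smooth_fun (\<lambda>x. of_real x)"
  unfolding smooth_fun_def
proof (intro exI[of _ "\<lambda>n x. if n = 0 then of_real x else if n = 1 then 1 else 0"] conjI allI)
  fix n :: nat and x :: real
  have "((\<lambda>x. complex_of_real x) has_vector_derivative 1) (at x)"
    using has_vector_derivative_of_real[OF DERIV_ident] by simp
  then show "((\<lambda>x. if n = 0 then complex_of_real x else if n = 1 then 1 else 0) has_vector_derivative
    (if Suc n = 0 then of_real x else if Suc n = 1 then 1 else 0)) (at x)"
    by (cases "n = 0"; cases "n = 1") auto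
qed simp

lemma smooth_fun_exp: "smooth_fun (\<lambda>x. of_real (exp (a * x)))"
  unfolding smooth_fun_def
proof (intro exI[of _ "\<lambda>n x. of_real (a ^ n * exp (a * x))"] conjI allI)
  fix n :: nat and x :: real
  have "((\<lambda>x. a ^ n * exp (a * x)) has_field_derivative a ^ Suc n * exp (a * x)) (at x)"
    by (auto intro!: derivative_eq_intros)
  then show "((\<lambda>x. complex_of_real (a ^ n * exp (a * x))) has_vector_derivative
    of_real (a ^ Suc n * exp (a * x))) (at x)"
    by (rule has_vector_derivative_of_real)
qed simp

lemma smooth_fun_add:
  assumes "smooth_fun f" "smooth_fun g" shows "smooth_fun (\<lambda>x. f x + g x)"
proof -
  from assms obtain F G where "F 0 = f" "G 0 = g"
    "\<And>n x. (F n has_vector_derivative F (Suc n) x) (at x)"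
    "\<And>n x. (G n has_vector_derivative G (Suc n) x) (at x)"
    unfolding smooth_fun_def by blast
  then show ?thesis unfolding smooth_fun_def
    by (intro exI[of _ "\<lambda>n x. F n x + G n x"]) (auto intro!: has_vector_derivative_add)
qed

lemma smooth_fun_mult:
  assumes "smooth_fun f" "smooth_fun g" shows "smooth_fun (\<lambda>x. f x * g x)"
proof -
  from assms obtain F G where FG: "F 0 = f" "G 0 = g"
    "\<And>n x. (F n has_vector_derivative F (Suc n) x) (at x)"
    "\<And>n x. (G n has_vector_derivative G (Suc n) x) (at x)"
    unfolding smooth_fun_def by blast
  define H where "H n x = (\<Sum>k\<le>n. of_nat (n choose k) * (F k x * G (n - k) x))" for n x
  have "(H n has_vector_derivative H (Suc n) x) (at x)" for n x
  proof -
    have "(H n has_vector_derivative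
      (\<Sum>k\<le>n. of_nat (n choose k) * (F k x * G (Suc (n - k)) x + F (Suc k) x * G (n - k) x))) (at x)"
      unfolding H_def
      by (intro has_vector_derivative_sum has_vector_derivative_mult_right has_vector_derivative_mult FG)
    also have "(\<Sum>k\<le>n. of_nat (n choose k) * (F k x * G (Suc (n - k)) x + F (Suc k) x * G (n - k) x))
      = (\<Sum>k\<le>n. of_nat (n choose k) * (F k x * G (Suc n - k) x))
        + (\<Sum>k\<le>n. of_nat (n choose k) * (F (Suc k) x * G (n - k) x))"
      by (simp add: ring_distribs sum.distrib Suc_diff_le)
    also have "(\<Sum>k\<le>n. of_nat (n choose k) * (F k x * G (Suc n - k) x))
      = (\<Sum>k\<le>Suc n. of_nat (n choose k) * (F k x * G (Suc n - k) x))"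
      by (simp add: binomial_eq_0)
    also have "\<dots> = F 0 x * G (Suc n) x + (\<Sum>k\<le>n. of_nat (n choose Suc k) * (F (Suc k) x * G (n - k) x))"
      by (subst sum.atMost_Suc_shift) simp
    also have "\<dots> + (\<Sum>k\<le>n. of_nat (n choose k) * (F (Suc k) x * G (n - k) x))
      = F 0 x * G (Suc n) x + (\<Sum>k\<le>n. of_nat (Suc n choose Suc k) * (F (Suc k) x * G (n - k) x))"
      by (simp add: ring_distribs sum.distrib add.assoc add.commute)
    also have "\<dots> = H (Suc n) x"
      unfolding H_def by (subst sum.atMost_Suc_shift) simp
    finally show ?thesis .
  qed
  moreover have "H 0 = (\<lambda>x. f x * g x)" by (simp add: H_def FG fun_eq_iff)
  ultimately show ?thesis unfolding smooth_fun_def by blast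
qed

section \<open>The homomorphism from \<open>Z_UR\<close> to the smooth functions\<close>

lemma Cat_cx_algebra: "cx_algebra (Cat hb)"
  by (simp add: Cat_def presented_cx_algebra)

lemma cat_elt_closed: "cat_elt hb g \<in> carrier (Cat hb)"
  unfolding Cat_def cat_elt_def presented_carrier by (rule exI[of _ "Gen g"]) simp

lemma gen_subalg_carrier:
  assumes "cx_algebra A" "X \<subseteq> carrier A"
  shows "gen_subalg A X \<subseteq> carrier A"
proof -
  interpret A: cx_algebra A by fact
  show ?thesis
  proof
    fix x assume "x \<in> gen_subalg A X"
    then show "x \<in> carrier A"
      by (induction rule: gen_subalg.induct) (use assms(2) in \<open>auto simp: A.smult_closed\<close>)
  qed
qed

lemma Z_UR_carrier: "Z_UR hb \<subseteq> carrier (Cat hb)"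
  unfolding Z_UR_def by (rule gen_subalg_carrier[OF Cat_cx_algebra]) (auto simp: cat_elt_closed)

text \<open>The algebra acts on functions: \<open>U\<close> and \<open>R\<close> by multiplication, \<open>W\<close> by translation.\<close>

fun cat_act :: "real \<Rightarrow> cat_gen alg_term \<Rightarrow> (real \<Rightarrow> complex) \<Rightarrow> real \<Rightarrow> complex" where
  "cat_act hb (Gen GU) f = (\<lambda>x. of_real x * f x)"
| "cat_act hb (Gen GR) f = (\<lambda>x. of_real (exp x) * f x)"
| "cat_act hb (Gen GRi) f = (\<lambda>x. of_real (exp (- x)) * f x)"
| "cat_act hb (Gen GW) f = (\<lambda>x. f (x + hb))"
| "cat_act hb (Gen GWi) f = (\<lambda>x. f (x - hb))"
| "cat_act hb (Cst c) f = (\<lambda>x. c * f x)"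
| "cat_act hb (Add s t) f = (\<lambda>x. cat_act hb s f x + cat_act hb t f x)"
| "cat_act hb (Mul s t) f = cat_act hb s (cat_act hb t f)"

lemma cat_act_linear:
  "cat_act hb t (\<lambda>x. f x + g x) = (\<lambda>x. cat_act hb t f x + cat_act hb t g x)"
  "cat_act hb t (\<lambda>x. c * f x) = (\<lambda>x. c * cat_act hb t f x)"
proof -
  have "(\<forall>f g. cat_act hb t (\<lambda>x. f x + g x) = (\<lambda>x. cat_act hb t f x + cat_act hb t g x)) \<and>
    (\<forall>f c. cat_act hb t (\<lambda>x. c * f x) = (\<lambda>x. c * cat_act hb t f x))"
  proof (induction t)
    case (Gen g) then show ?case by (cases g) (auto simp: algebra_simps)
  next
    case (Add s t) then show ?case by (simp add: algebra_simps)
  qed (auto simp: algebra_simps)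
  then show "cat_act hb t (\<lambda>x. f x + g x) = (\<lambda>x. cat_act hb t f x + cat_act hb t g x)"
    "cat_act hb t (\<lambda>x. c * f x) = (\<lambda>x. c * cat_act hb t f x)" by blast+
qed

lemma cat_act_rels:
  assumes "(s, t) \<in> cat_rels hb" shows "cat_act hb s f = cat_act hb t f"
  using assms unfolding cat_rels_def Let_def
  by (auto simp: fun_eq_iff algebra_simps exp_of_real[symmetric] simp flip: of_real_mult of_real_add
      exp_add exp_minus of_real_minus) (simp_all add: exp_of_real exp_add exp_diff exp_minus field_simps)

lemma cat_act_alg_eq:
  assumes "alg_eq UNIV (cat_rels hb) s t" shows "cat_act hb s = cat_act hb t"
  using assms
proof (induction rule: alg_eq.induct)
  case (eq_rel s t) then show ?case using cat_act_rels by blast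
next
  case (eq_mul_cong s s' t t') then show ?case by (simp add: fun_eq_iff[where f = "cat_act hb (Mul _ _)"])
qed (auto simp: cat_act_linear fun_eq_iff algebra_simps)

definition cat_rep :: "real \<Rightarrow> cat_elem \<Rightarrow> (real \<Rightarrow> complex) \<Rightarrow> real \<Rightarrow> complex" where
  "cat_rep hb X = cat_act hb (SOME t. t \<in> X)"

lemma cat_rep_class: "cat_rep hb (term_class UNIV (cat_rels hb) t) = cat_act hb t"
proof -
  let ?X = "term_class UNIV (cat_rels hb) t"
  have "t \<in> ?X" by (simp add: term_class_def alg_eq.eq_refl)
  then have "(SOME s. s \<in> ?X) \<in> ?X" by (rule someI)
  then show ?thesis
    using cat_act_alg_eq by (simp add: cat_rep_def term_class_def)
qed

lemma cat_rep_ops: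
  assumes "X \<in> carrier (Cat hb)" "Y \<in> carrier (Cat hb)"
  shows "cat_rep hb (X \<otimes>\<^bsub>Cat hb\<^esub> Y) f = cat_rep hb X (cat_rep hb Y f)"
    and "cat_rep hb (X \<oplus>\<^bsub>Cat hb\<^esub> Y) f = (\<lambda>x. cat_rep hb X f x + cat_rep hb Y f x)"
    and "cat_rep hb (c \<odot>\<^bsub>Cat hb\<^esub> X) f = (\<lambda>x. c * cat_rep hb X f x)"
    and "cat_rep hb \<one>\<^bsub>Cat hb\<^esub> f = f"
proof -
  from assms obtain s t where "X = term_class UNIV (cat_rels hb) s" "Y = term_class UNIV (cat_rels hb) t"
    by (auto simp: Cat_def presented_carrier)
  then show "cat_rep hb (X \<otimes>\<^bsub>Cat hb\<^esub> Y) f = cat_rep hb X (cat_rep hb Y f)"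
    "cat_rep hb (X \<oplus>\<^bsub>Cat hb\<^esub> Y) f = (\<lambda>x. cat_rep hb X f x + cat_rep hb Y f x)"
    "cat_rep hb (c \<odot>\<^bsub>Cat hb\<^esub> X) f = (\<lambda>x. c * cat_rep hb X f x)"
    "cat_rep hb \<one>\<^bsub>Cat hb\<^esub> f = f"
    by (simp_all add: Cat_def presented_ops presented_smult presented_consts cat_rep_class)
qed

lemma cat_rep_Z_UR:
  assumes "z \<in> Z_UR hb"
  shows "\<exists>g. smooth_fun g \<and> (\<forall>f. cat_rep hb z f = (\<lambda>x. g x * f x))"
  using assms unfolding Z_UR_def
proof (induction rule: gen_subalg.induct)
  case (sub_gen z)
  have "smooth_fun (\<lambda>x. of_real (exp x))" "smooth_fun (\<lambda>x. of_real (exp (- x)))"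
    using smooth_fun_exp[of 1] smooth_fun_exp[of "-1"] by simp_all
  then show ?case using sub_gen smooth_fun_ident
    by (auto simp: cat_elt_def cat_rep_class)
next
  case sub_one
  interpret C: cx_algebra "Cat hb" by (rule Cat_cx_algebra)
  show ?case using cat_rep_ops(4)[OF C.one_closed C.one_closed] smooth_fun_const[of 1]
    by (intro exI[of _ "\<lambda>x. 1"]) simp
next
  case (sub_smult z c)
  then have "z \<in> carrier (Cat hb)" using Z_UR_carrier by (auto simp: Z_UR_def)
  moreover obtain g where "smooth_fun g" "\<forall>f. cat_rep hb z f = (\<lambda>x. g x * f x)" using sub_smult by auto
  ultimately show ?case using smooth_fun_mult[OF smooth_fun_const, of g c]
    by (intro exI[of _ "\<lambda>x. c * g x"]) (simp add: cat_rep_ops mult.assoc)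
next
  case (sub_add y z)
  then have "y \<in> carrier (Cat hb)" "z \<in> carrier (Cat hb)" using Z_UR_carrier by (auto simp: Z_UR_def)
  moreover obtain g g' where "smooth_fun g" "\<forall>f. cat_rep hb y f = (\<lambda>x. g x * f x)"
    "smooth_fun g'" "\<forall>f. cat_rep hb z f = (\<lambda>x. g' x * f x)" using sub_add by auto
  ultimately show ?case using smooth_fun_add[of g g']
    by (intro exI[of _ "\<lambda>x. g x + g' x"]) (simp add: cat_rep_ops ring_distribs)
next
  case (sub_mult y z)
  then have "y \<in> carrier (Cat hb)" "z \<in> carrier (Cat hb)" using Z_UR_carrier by (auto simp: Z_UR_def)
  moreover obtain g g' where "smooth_fun g" "\<forall>f. cat_rep hb y f = (\<lambda>x. g x * f x)"
    "smooth_fun g'" "\<forall>f. cat_rep hb z f = (\<lambda>x. g' x * f x)" using sub_mult by auto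
  ultimately show ?case using smooth_fun_mult[of g g']
    by (intro exI[of _ "\<lambda>x. g x * g' x"]) (simp add: cat_rep_ops mult.assoc)
qed

lemma Z_UR_closed:
  "\<one>\<^bsub>Cat hb\<^esub> \<in> Z_UR hb"
  "x \<in> Z_UR hb \<Longrightarrow> c \<odot>\<^bsub>Cat hb\<^esub> x \<in> Z_UR hb"
  "x \<in> Z_UR hb \<Longrightarrow> y \<in> Z_UR hb \<Longrightarrow> x \<oplus>\<^bsub>Cat hb\<^esub> y \<in> Z_UR hb"
  "x \<in> Z_UR hb \<Longrightarrow> y \<in> Z_UR hb \<Longrightarrow> x \<otimes>\<^bsub>Cat hb\<^esub> y \<in> Z_UR hb"
  "cat_elt hb GU \<in> Z_UR hb" "cat_elt hb GR \<in> Z_UR hb" "cat_elt hb GRi \<in> Z_UR hb"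
  by (simp_all add: Z_UR_def gen_subalg.intros)

lemma is_cat_phi_exists: "is_cat_phi hb (\<lambda>z \<in> Z_UR hb. cat_rep hb z (\<lambda>u. 1))"
proof -
  interpret C: cx_algebra "Cat hb" by (rule Cat_cx_algebra)
  let ?phi = "\<lambda>z \<in> Z_UR hb. cat_rep hb z (\<lambda>u. 1)"
  have rep: "cat_rep hb z f = (\<lambda>u. cat_rep hb z (\<lambda>u. 1) u * f u)"
    "smooth_fun (cat_rep hb z (\<lambda>u. 1))" if "z \<in> Z_UR hb" for z f
    using cat_rep_Z_UR[OF that] by auto
  have car: "z \<in> carrier (Cat hb)" if "z \<in> Z_UR hb" for z using that Z_UR_carrier by blast
  have mult: "cat_rep hb (x \<otimes>\<^bsub>Cat hb\<^esub> y) (\<lambda>u. 1) =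
      (\<lambda>u. cat_rep hb x (\<lambda>u. 1) u * cat_rep hb y (\<lambda>u. 1) u)"
    if "x \<in> Z_UR hb" "y \<in> Z_UR hb" for x y
    using rep(1)[OF that(1), of "cat_rep hb y (\<lambda>u. 1)"] that by (simp add: cat_rep_ops car)
  show ?thesis
    unfolding is_cat_phi_def alg_hom_def
    using cat_rep_ops(4)[OF C.one_closed C.one_closed]
    by (auto simp: Z_UR_closed car smooth_algebra_def rep(2) mult cat_rep_ops(2,3)[OF car car])
      (simp_all add: cat_elt_def cat_rep_class)
qed

lemma is_cat_phi_unique:
  assumes "is_cat_phi hb \<phi>" "is_cat_phi hb \<psi>" shows "\<phi> = \<psi>"
proof (rule extensionalityI)
  show "\<phi> \<in> extensional (Z_UR hb)" "\<psi> \<in> extensional (Z_UR hb)"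
    using assms by (auto simp: is_cat_phi_def)
  fix z assume "z \<in> Z_UR hb"
  then show "\<phi> z = \<psi> z"
    unfolding Z_UR_def
  proof (induction rule: gen_subalg.induct)
  qed (use assms in \<open>auto simp: is_cat_phi_def alg_hom_def Z_UR_def[symmetric]\<close>)
qed

lemma is_cat_phi_cat_phi: "is_cat_phi hb (cat_phi hb)"
  unfolding cat_phi_def
  using theI'[of "is_cat_phi hb"] is_cat_phi_exists is_cat_phi_unique by blast

section \<open>Homomorphisms out of \<open>Cat\<close> and \<open>CatLoc\<close>\<close>

lemma cat_rel_eq:
  assumes "(s, t) \<in> cat_rels hb"
  shows "term_class UNIV (cat_rels hb) s = term_class UNIV (cat_rels hb) t"
  using assms by (intro term_class_eqI alg_eq.eq_rel) auto

lemma cat_relations: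
  "cat_elt hb GW \<otimes>\<^bsub>Cat hb\<^esub> cat_elt hb GWi = \<one>\<^bsub>Cat hb\<^esub>"
  "cat_elt hb GWi \<otimes>\<^bsub>Cat hb\<^esub> cat_elt hb GW = \<one>\<^bsub>Cat hb\<^esub>"
  "cat_elt hb GR \<otimes>\<^bsub>Cat hb\<^esub> cat_elt hb GRi = \<one>\<^bsub>Cat hb\<^esub>"
  "cat_elt hb GRi \<otimes>\<^bsub>Cat hb\<^esub> cat_elt hb GR = \<one>\<^bsub>Cat hb\<^esub>"
  "cat_elt hb GR \<otimes>\<^bsub>Cat hb\<^esub> cat_elt hb GU = cat_elt hb GU \<otimes>\<^bsub>Cat hb\<^esub> cat_elt hb GR"
  "cat_elt hb GW \<otimes>\<^bsub>Cat hb\<^esub> cat_elt hb GR =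
     exp (of_real hb) \<odot>\<^bsub>Cat hb\<^esub> (cat_elt hb GR \<otimes>\<^bsub>Cat hb\<^esub> cat_elt hb GW)"
  "cat_elt hb GW \<otimes>\<^bsub>Cat hb\<^esub> cat_elt hb GU =
     cat_elt hb GU \<otimes>\<^bsub>Cat hb\<^esub> cat_elt hb GW \<oplus>\<^bsub>Cat hb\<^esub> of_real hb \<odot>\<^bsub>Cat hb\<^esub> cat_elt hb GW"
  unfolding Cat_def cat_elt_def
  by (simp_all add: presented_ops presented_smult presented_consts)
    (rule cat_rel_eq; simp add: cat_rels_def Let_def)+

lemma cat_universal:
  assumes B: "cx_algebra B" and u: "u \<in> carrier B" and r: "r \<in> Units B" and w: "w \<in> Units B"
    and ru: "r \<otimes>\<^bsub>B\<^esub> u = u \<otimes>\<^bsub>B\<^esub> r"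
    and wr: "w \<otimes>\<^bsub>B\<^esub> r = exp (of_real hb) \<odot>\<^bsub>B\<^esub> (r \<otimes>\<^bsub>B\<^esub> w)"
    and wu: "w \<otimes>\<^bsub>B\<^esub> u = u \<otimes>\<^bsub>B\<^esub> w \<oplus>\<^bsub>B\<^esub> of_real hb \<odot>\<^bsub>B\<^esub> w"
  shows "\<exists>F. alg_hom (Cat hb) B F \<and> F (cat_elt hb GU) = u \<and> F (cat_elt hb GR) = r \<and>
    F (cat_elt hb GW) = w \<and> F (cat_elt hb GRi) = inv\<^bsub>B\<^esub> r \<and> F (cat_elt hb GWi) = inv\<^bsub>B\<^esub> w"
proof -
  interpret B: cx_algebra B by fact
  let ?ri = "inv\<^bsub>B\<^esub> r" and ?wi = "inv\<^bsub>B\<^esub> w"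
  let ?q = "exp (complex_of_real hb)" and ?qi = "exp (- complex_of_real hb)" and ?h = "complex_of_real hb"
  have cl: "r \<in> carrier B" "w \<in> carrier B" "?ri \<in> carrier B" "?wi \<in> carrier B" "u \<in> carrier B"
    using r w u by auto
  note sm = B.smult_mult_l B.smult_mult_r B.smult_closed B.smult_one
  have can: "r \<otimes>\<^bsub>B\<^esub> ?ri = \<one>\<^bsub>B\<^esub>" "?ri \<otimes>\<^bsub>B\<^esub> r = \<one>\<^bsub>B\<^esub>" "w \<otimes>\<^bsub>B\<^esub> ?wi = \<one>\<^bsub>B\<^esub>" "?wi \<otimes>\<^bsub>B\<^esub> w = \<one>\<^bsub>B\<^esub>"
    using r w by auto
  have can': "r \<otimes>\<^bsub>B\<^esub> (?ri \<otimes>\<^bsub>B\<^esub> x) = x" "?ri \<otimes>\<^bsub>B\<^esub> (r \<otimes>\<^bsub>B\<^esub> x) = x"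
    "w \<otimes>\<^bsub>B\<^esub> (?wi \<otimes>\<^bsub>B\<^esub> x) = x" "?wi \<otimes>\<^bsub>B\<^esub> (w \<otimes>\<^bsub>B\<^esub> x) = x" if "x \<in> carrier B" for x
    using that cl can by (metis B.m_assoc B.l_one)+
  have qq: "?qi \<odot>\<^bsub>B\<^esub> (?q \<odot>\<^bsub>B\<^esub> x) = x" "?q \<odot>\<^bsub>B\<^esub> (?qi \<odot>\<^bsub>B\<^esub> x) = x" if "x \<in> carrier B" for x
    using that by (simp_all add: B.smult_smult[symmetric] B.smult_one exp_minus)
  have riu: "?ri \<otimes>\<^bsub>B\<^esub> u = u \<otimes>\<^bsub>B\<^esub> ?ri"
  proof -
    have "?ri \<otimes>\<^bsub>B\<^esub> u = ?ri \<otimes>\<^bsub>B\<^esub> ((u \<otimes>\<^bsub>B\<^esub> r) \<otimes>\<^bsub>B\<^esub> ?ri)" using cl can by (simp add: B.m_assoc)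
    also have "\<dots> = ?ri \<otimes>\<^bsub>B\<^esub> ((r \<otimes>\<^bsub>B\<^esub> u) \<otimes>\<^bsub>B\<^esub> ?ri)" by (simp add: ru)
    also have "\<dots> = u \<otimes>\<^bsub>B\<^esub> ?ri" using cl can' by (simp add: B.m_assoc)
    finally show ?thesis .
  qed
  have rw: "r \<otimes>\<^bsub>B\<^esub> w = ?qi \<odot>\<^bsub>B\<^esub> (w \<otimes>\<^bsub>B\<^esub> r)" using cl by (simp add: wr qq)
  have wri: "w \<otimes>\<^bsub>B\<^esub> ?ri = ?qi \<odot>\<^bsub>B\<^esub> (?ri \<otimes>\<^bsub>B\<^esub> w)"
  proof -
    have "w \<otimes>\<^bsub>B\<^esub> ?ri = ?ri \<otimes>\<^bsub>B\<^esub> ((r \<otimes>\<^bsub>B\<^esub> w) \<otimes>\<^bsub>B\<^esub> ?ri)" using cl can' by (simp add: B.m_assoc)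
    also have "\<dots> = ?qi \<odot>\<^bsub>B\<^esub> (?ri \<otimes>\<^bsub>B\<^esub> ((w \<otimes>\<^bsub>B\<^esub> r) \<otimes>\<^bsub>B\<^esub> ?ri))"
      using cl by (simp only: rw sm B.m_closed)
    also have "\<dots> = ?qi \<odot>\<^bsub>B\<^esub> (?ri \<otimes>\<^bsub>B\<^esub> w)" using cl can by (simp add: B.m_assoc)
    finally show ?thesis .
  qed
  have wir: "?wi \<otimes>\<^bsub>B\<^esub> r = ?qi \<odot>\<^bsub>B\<^esub> (r \<otimes>\<^bsub>B\<^esub> ?wi)"
  proof -
    have "?wi \<otimes>\<^bsub>B\<^esub> r = ?wi \<otimes>\<^bsub>B\<^esub> ((r \<otimes>\<^bsub>B\<^esub> w) \<otimes>\<^bsub>B\<^esub> ?wi)" using cl can by (simp add: B.m_assoc)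
    also have "\<dots> = ?qi \<odot>\<^bsub>B\<^esub> (?wi \<otimes>\<^bsub>B\<^esub> ((w \<otimes>\<^bsub>B\<^esub> r) \<otimes>\<^bsub>B\<^esub> ?wi))"
      using cl by (simp only: rw sm B.m_closed)
    also have "\<dots> = ?qi \<odot>\<^bsub>B\<^esub> (r \<otimes>\<^bsub>B\<^esub> ?wi)" using cl can' by (simp add: B.m_assoc)
    finally show ?thesis .
  qed
  have wiri: "?wi \<otimes>\<^bsub>B\<^esub> ?ri = ?q \<odot>\<^bsub>B\<^esub> (?ri \<otimes>\<^bsub>B\<^esub> ?wi)"
  proof -
    have "?ri \<otimes>\<^bsub>B\<^esub> ?wi = ?ri \<otimes>\<^bsub>B\<^esub> ((?wi \<otimes>\<^bsub>B\<^esub> r) \<otimes>\<^bsub>B\<^esub> ?ri)" using cl can by (simp add: B.m_assoc)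
    also have "\<dots> = ?qi \<odot>\<^bsub>B\<^esub> (?ri \<otimes>\<^bsub>B\<^esub> ((r \<otimes>\<^bsub>B\<^esub> ?wi) \<otimes>\<^bsub>B\<^esub> ?ri))"
      using cl by (simp only: wir sm B.m_closed)
    also have "\<dots> = ?qi \<odot>\<^bsub>B\<^esub> (?wi \<otimes>\<^bsub>B\<^esub> ?ri)" using cl can' by (simp add: B.m_assoc)
    finally show ?thesis using cl by (simp add: qq)
  qed
  have wiu: "?wi \<otimes>\<^bsub>B\<^esub> u = u \<otimes>\<^bsub>B\<^esub> ?wi \<oplus>\<^bsub>B\<^esub> (- ?h) \<odot>\<^bsub>B\<^esub> ?wi"
  proof -
    have "u \<otimes>\<^bsub>B\<^esub> ?wi = ?wi \<otimes>\<^bsub>B\<^esub> ((w \<otimes>\<^bsub>B\<^esub> u) \<otimes>\<^bsub>B\<^esub> ?wi)" using cl can' by (simp add: B.m_assoc)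
    also have "\<dots> = ?wi \<otimes>\<^bsub>B\<^esub> u \<oplus>\<^bsub>B\<^esub> ?h \<odot>\<^bsub>B\<^esub> ?wi"
      using cl can can' by (simp add: wu B.l_distr B.r_distr sm B.m_assoc)
    finally have "u \<otimes>\<^bsub>B\<^esub> ?wi \<oplus>\<^bsub>B\<^esub> (- ?h) \<odot>\<^bsub>B\<^esub> ?wi =
      ?wi \<otimes>\<^bsub>B\<^esub> u \<oplus>\<^bsub>B\<^esub> (?h \<odot>\<^bsub>B\<^esub> ?wi \<oplus>\<^bsub>B\<^esub> (- ?h) \<odot>\<^bsub>B\<^esub> ?wi)"
      using cl by (simp add: B.a_assoc sm)
    also have "?h \<odot>\<^bsub>B\<^esub> ?wi \<oplus>\<^bsub>B\<^esub> (- ?h) \<odot>\<^bsub>B\<^esub> ?wi = \<zero>\<^bsub>B\<^esub>"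
      using cl by (simp add: B.smult_l_distr[symmetric] B.smult_zero_scalar)
    finally show ?thesis using cl by simp
  qed
  let ?f = "case_cat_gen u r ?ri w ?wi"
  have "\<exists>F. alg_hom (presented UNIV (cat_rels hb)) B F \<and>
    (\<forall>g \<in> UNIV. F (term_class UNIV (cat_rels hb) (Gen g)) = ?f g)"
  proof (rule presented_universal[OF B])
    show "?f g \<in> carrier B" for g using cl by (cases g) auto
    show "term_eval B ?f s = term_eval B ?f t" if "(s, t) \<in> cat_rels hb" for s t
      using that cl
      by (auto simp: cat_rels_def Let_def can sm ru riu wr wri wir wiri wu wiu)
  qed
  then show ?thesis by (auto simp: Cat_def cat_elt_def)
qed

lemma Z_plus_carrier: "Z_plus hb \<subseteq> carrier (Cat hb)"
  using Z_UR_carrier by (auto simp: Z_plus_def)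

lemma CatLoc_cx_algebra: "cx_algebra (CatLoc hb)"
  by (simp add: CatLoc_def localization_cx_algebra)

lemma cat_loc_map_hom: "alg_hom (Cat hb) (CatLoc hb) (loc_map (Cat hb) (Z_plus hb))"
  unfolding CatLoc_def by (rule loc_map_hom[OF Cat_cx_algebra])

lemma elt_closed: "elt hb g \<in> carrier (CatLoc hb)"
  unfolding elt_def by (rule alg_homD(1)[OF cat_loc_map_hom cat_elt_closed])

lemma elt_relations:
  "elt hb GW \<otimes>\<^bsub>CatLoc hb\<^esub> elt hb GWi = \<one>\<^bsub>CatLoc hb\<^esub>"
  "elt hb GWi \<otimes>\<^bsub>CatLoc hb\<^esub> elt hb GW = \<one>\<^bsub>CatLoc hb\<^esub>"
  "elt hb GR \<otimes>\<^bsub>CatLoc hb\<^esub> elt hb GRi = \<one>\<^bsub>CatLoc hb\<^esub>"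
  "elt hb GRi \<otimes>\<^bsub>CatLoc hb\<^esub> elt hb GR = \<one>\<^bsub>CatLoc hb\<^esub>"
  "elt hb GR \<otimes>\<^bsub>CatLoc hb\<^esub> elt hb GU = elt hb GU \<otimes>\<^bsub>CatLoc hb\<^esub> elt hb GR"
  "elt hb GW \<otimes>\<^bsub>CatLoc hb\<^esub> elt hb GR =
     exp (of_real hb) \<odot>\<^bsub>CatLoc hb\<^esub> (elt hb GR \<otimes>\<^bsub>CatLoc hb\<^esub> elt hb GW)"
  "elt hb GW \<otimes>\<^bsub>CatLoc hb\<^esub> elt hb GU =
     elt hb GU \<otimes>\<^bsub>CatLoc hb\<^esub> elt hb GW \<oplus>\<^bsub>CatLoc hb\<^esub> of_real hb \<odot>\<^bsub>CatLoc hb\<^esub> elt hb GW"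
proof -
  interpret C: cx_algebra "Cat hb" by (rule Cat_cx_algebra)
  note h = alg_homD[OF cat_loc_map_hom[of hb]]
  note r = cat_relations[of hb, THEN arg_cong[where f = "loc_map (Cat hb) (Z_plus hb)"]]
  show "elt hb GW \<otimes>\<^bsub>CatLoc hb\<^esub> elt hb GWi = \<one>\<^bsub>CatLoc hb\<^esub>"
    "elt hb GWi \<otimes>\<^bsub>CatLoc hb\<^esub> elt hb GW = \<one>\<^bsub>CatLoc hb\<^esub>"
    "elt hb GR \<otimes>\<^bsub>CatLoc hb\<^esub> elt hb GRi = \<one>\<^bsub>CatLoc hb\<^esub>"
    "elt hb GRi \<otimes>\<^bsub>CatLoc hb\<^esub> elt hb GR = \<one>\<^bsub>CatLoc hb\<^esub>"
    "elt hb GR \<otimes>\<^bsub>CatLoc hb\<^esub> elt hb GU = elt hb GU \<otimes>\<^bsub>CatLoc hb\<^esub> elt hb GR"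
    "elt hb GW \<otimes>\<^bsub>CatLoc hb\<^esub> elt hb GR =
       exp (of_real hb) \<odot>\<^bsub>CatLoc hb\<^esub> (elt hb GR \<otimes>\<^bsub>CatLoc hb\<^esub> elt hb GW)"
    "elt hb GW \<otimes>\<^bsub>CatLoc hb\<^esub> elt hb GU =
       elt hb GU \<otimes>\<^bsub>CatLoc hb\<^esub> elt hb GW \<oplus>\<^bsub>CatLoc hb\<^esub> of_real hb \<odot>\<^bsub>CatLoc hb\<^esub> elt hb GW"
    using r by (simp_all add: elt_def h C.smult_closed cat_elt_closed)
qed

lemma elt_Units:
  "elt hb GR \<in> Units (CatLoc hb)" "inv\<^bsub>CatLoc hb\<^esub> (elt hb GR) = elt hb GRi"
  "elt hb GW \<in> Units (CatLoc hb)" "inv\<^bsub>CatLoc hb\<^esub> (elt hb GW) = elt hb GWi"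
proof -
  interpret L: cx_algebra "CatLoc hb" by (rule CatLoc_cx_algebra)
  show "elt hb GR \<in> Units (CatLoc hb)" "elt hb GW \<in> Units (CatLoc hb)"
    using elt_relations(1-4)[of hb] by (auto simp: Units_def elt_closed intro!: bexI)
  show "inv\<^bsub>CatLoc hb\<^esub> (elt hb GR) = elt hb GRi" "inv\<^bsub>CatLoc hb\<^esub> (elt hb GW) = elt hb GWi"
    by (rule L.inv_unique'[OF elt_closed elt_closed elt_relations(3,4), symmetric],
        rule L.inv_unique'[OF elt_closed elt_closed elt_relations(1,2), symmetric])
qed

lemma cat_hom_unique:
  assumes B: "cx_algebra B" and F: "alg_hom (Cat hb) B F" and F': "alg_hom (Cat hb) B F'"
    and eq: "F (cat_elt hb GU) = F' (cat_elt hb GU)" "F (cat_elt hb GR) = F' (cat_elt hb GR)"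
      "F (cat_elt hb GW) = F' (cat_elt hb GW)"
    and X: "X \<in> carrier (Cat hb)"
  shows "F X = F' X"
proof -
  interpret C: cx_algebra "Cat hb" by (rule Cat_cx_algebra)
  have u: "cat_elt hb GR \<in> Units (Cat hb)" "cat_elt hb GW \<in> Units (Cat hb)"
    using cat_relations(1-4)[of hb] by (auto simp: Units_def cat_elt_closed intro!: bexI)
  have i: "inv\<^bsub>Cat hb\<^esub> (cat_elt hb GR) = cat_elt hb GRi" "inv\<^bsub>Cat hb\<^esub> (cat_elt hb GW) = cat_elt hb GWi"
    by (rule C.inv_unique'[OF cat_elt_closed cat_elt_closed cat_relations(3,4), symmetric],
        rule C.inv_unique'[OF cat_elt_closed cat_elt_closed cat_relations(1,2), symmetric])
  note hu = alg_hom_Units(2)[OF Cat_cx_algebra B]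
  have "F (cat_elt hb g) = F' (cat_elt hb g)" for g
    using eq hu[OF F u(1)] hu[OF F u(2)] hu[OF F' u(1)] hu[OF F' u(2)] i by (cases g) auto
  then show ?thesis
    using presented_hom_unique[OF B F[unfolded Cat_def] F'[unfolded Cat_def]] X
    by (simp add: Cat_def cat_elt_def)
qed

lemma cat_loc_hom_unique:
  assumes B: "cx_algebra B" and F: "alg_hom (CatLoc hb) B F" and F': "alg_hom (CatLoc hb) B F'"
    and eq: "F (elt hb GU) = F' (elt hb GU)" "F (elt hb GR) = F' (elt hb GR)"
      "F (elt hb GW) = F' (elt hb GW)"
    and X: "X \<in> carrier (CatLoc hb)"
  shows "F X = F' X"
proof -
  have "F (loc_map (Cat hb) (Z_plus hb) a) = F' (loc_map (Cat hb) (Z_plus hb) a)"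
    if "a \<in> carrier (Cat hb)" for a
    using cat_hom_unique[OF B alg_hom_comp[OF cat_loc_map_hom F] alg_hom_comp[OF cat_loc_map_hom F']]
      eq that by (simp add: elt_def)
  then show ?thesis
    using localization_hom_unique[OF Cat_cx_algebra B Z_plus_carrier F[unfolded CatLoc_def]
        F'[unfolded CatLoc_def]] X
    by (simp add: CatLoc_def)
qed

lemma cat_loc_universal:
  assumes B: "cx_algebra B" and F: "alg_hom (Cat hb) B F"
    and U: "\<And>p. p \<in> Z_plus hb \<Longrightarrow> F p \<in> Units B"
  shows "\<exists>H. alg_hom (CatLoc hb) B H \<and> (\<forall>g. H (elt hb g) = F (cat_elt hb g))"
  using localization_universal[OF Cat_cx_algebra B Z_plus_carrier F U]
  by (auto simp: CatLoc_def elt_def cat_elt_closed)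

section \<open>Existence and uniqueness of the derivations\<close>

definition dual_algebra :: "(complex, 'a) module \<Rightarrow> (complex, 'a \<times> 'a) module" where
  "dual_algebra A =
     \<lparr> carrier = carrier A \<times> carrier A,
       monoid.mult = (\<lambda>(a, b) (c, d). (a \<otimes>\<^bsub>A\<^esub> c, b \<otimes>\<^bsub>A\<^esub> c \<oplus>\<^bsub>A\<^esub> a \<otimes>\<^bsub>A\<^esub> d)),
       one = (\<one>\<^bsub>A\<^esub>, \<zero>\<^bsub>A\<^esub>),
       zero = (\<zero>\<^bsub>A\<^esub>, \<zero>\<^bsub>A\<^esub>),
       add = (\<lambda>(a, b) (c, d). (a \<oplus>\<^bsub>A\<^esub> c, b \<oplus>\<^bsub>A\<^esub> d)),
       smult = (\<lambda>c (a, b). (c \<odot>\<^bsub>A\<^esub> a, c \<odot>\<^bsub>A\<^esub> b)) \<rparr>"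

lemma dual_simps:
  "carrier (dual_algebra A) = carrier A \<times> carrier A"
  "(a, b) \<otimes>\<^bsub>dual_algebra A\<^esub> (c, d) = (a \<otimes>\<^bsub>A\<^esub> c, b \<otimes>\<^bsub>A\<^esub> c \<oplus>\<^bsub>A\<^esub> a \<otimes>\<^bsub>A\<^esub> d)"
  "\<one>\<^bsub>dual_algebra A\<^esub> = (\<one>\<^bsub>A\<^esub>, \<zero>\<^bsub>A\<^esub>)"
  "\<zero>\<^bsub>dual_algebra A\<^esub> = (\<zero>\<^bsub>A\<^esub>, \<zero>\<^bsub>A\<^esub>)"
  "(a, b) \<oplus>\<^bsub>dual_algebra A\<^esub> (c, d) = (a \<oplus>\<^bsub>A\<^esub> c, b \<oplus>\<^bsub>A\<^esub> d)"
  "k \<odot>\<^bsub>dual_algebra A\<^esub> (a, b) = (k \<odot>\<^bsub>A\<^esub> a, k \<odot>\<^bsub>A\<^esub> b)"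
  by (simp_all add: dual_algebra_def)

lemma dual_cx_algebra:
  assumes "cx_algebra A" shows "cx_algebra (dual_algebra A)"
proof -
  interpret A: cx_algebra A by fact
  have ag: "abelian_group (dual_algebra A)"
  proof (rule abelian_groupI)
    fix x assume "x \<in> carrier (dual_algebra A)"
    then obtain a b where x: "x = (a, b)" "a \<in> carrier A" "b \<in> carrier A"
      by (auto simp: dual_simps)
    then show "\<exists>y\<in>carrier (dual_algebra A). y \<oplus>\<^bsub>dual_algebra A\<^esub> x = \<zero>\<^bsub>dual_algebra A\<^esub>"
      by (intro bexI[of _ "(\<ominus>\<^bsub>A\<^esub> a, \<ominus>\<^bsub>A\<^esub> b)"]) (auto simp: dual_simps A.l_neg)
  qed (auto simp: dual_simps A.a_ac)
  have mo: "Group.monoid (dual_algebra A)"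
    by (rule monoidI) (auto simp: dual_simps A.m_assoc A.l_distr A.r_distr A.a_ac)
  interpret D: ring "dual_algebra A"
    by (rule ringI[OF ag mo]) (auto simp: dual_simps A.l_distr A.r_distr A.a_ac)
  show ?thesis
    by unfold_locales
      (auto simp: dual_simps A.smult_closed A.smult_l_distr A.smult_r_distr A.smult_smult
        A.smult_one A.smult_mult_l A.smult_mult_r)
qed

lemma dual_Units:
  assumes "cx_algebra A" "a \<in> Units A" "b \<in> carrier A"
  shows "(a, b) \<in> Units (dual_algebra A)"
proof -
  interpret A: cx_algebra A by fact
  let ?i = "inv\<^bsub>A\<^esub> a"
  have cl: "a \<in> carrier A" "?i \<in> carrier A" using assms by auto
  have can: "a \<otimes>\<^bsub>A\<^esub> ?i = \<one>\<^bsub>A\<^esub>" "?i \<otimes>\<^bsub>A\<^esub> a = \<one>\<^bsub>A\<^esub>" using assms by auto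
  have can': "a \<otimes>\<^bsub>A\<^esub> (?i \<otimes>\<^bsub>A\<^esub> x) = x" if "x \<in> carrier A" for x
    using that cl can by (metis A.m_assoc A.l_one)
  let ?j = "(?i, \<ominus>\<^bsub>A\<^esub> (?i \<otimes>\<^bsub>A\<^esub> (b \<otimes>\<^bsub>A\<^esub> ?i)))"
  have "(a, b) \<otimes>\<^bsub>dual_algebra A\<^esub> ?j = \<one>\<^bsub>dual_algebra A\<^esub>"
    using cl assms(3) can can' by (simp add: dual_simps A.r_minus A.r_neg)
  moreover have "?j \<otimes>\<^bsub>dual_algebra A\<^esub> (a, b) = \<one>\<^bsub>dual_algebra A\<^esub>"
    using cl assms(3) can by (simp add: dual_simps A.l_minus A.m_assoc A.l_neg)
  moreover have "(a, b) \<in> carrier (dual_algebra A)" "?j \<in> carrier (dual_algebra A)"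
    using cl assms(3) by (auto simp: dual_simps)
  ultimately show ?thesis unfolding Units_def by blast
qed

lemma is_derivationD:
  assumes "is_derivation A d"
  shows "x \<in> carrier A \<Longrightarrow> d x \<in> carrier A"
    and "x \<in> carrier A \<Longrightarrow> y \<in> carrier A \<Longrightarrow> d (x \<oplus>\<^bsub>A\<^esub> y) = d x \<oplus>\<^bsub>A\<^esub> d y"
    and "x \<in> carrier A \<Longrightarrow> d (c \<odot>\<^bsub>A\<^esub> x) = c \<odot>\<^bsub>A\<^esub> d x"
    and "x \<in> carrier A \<Longrightarrow> y \<in> carrier A \<Longrightarrow>
      d (x \<otimes>\<^bsub>A\<^esub> y) = (d x \<otimes>\<^bsub>A\<^esub> y) \<oplus>\<^bsub>A\<^esub> (x \<otimes>\<^bsub>A\<^esub> d y)"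
  using assms by (auto simp: is_derivation_def)

lemma derivation_one:
  assumes "cx_algebra A" "is_derivation A d" shows "d \<one>\<^bsub>A\<^esub> = \<zero>\<^bsub>A\<^esub>"
proof -
  interpret A: cx_algebra A by fact
  have "d \<one>\<^bsub>A\<^esub> \<in> carrier A" using is_derivationD(1)[OF assms(2)] by simp
  moreover have "d \<one>\<^bsub>A\<^esub> = d \<one>\<^bsub>A\<^esub> \<oplus>\<^bsub>A\<^esub> d \<one>\<^bsub>A\<^esub>"
    using is_derivationD(4)[OF assms(2) A.one_closed A.one_closed] calculation by simp
  ultimately show ?thesis by simp
qed

lemma derivation_hom:
  assumes "cx_algebra A" "is_derivation A d"
  shows "alg_hom A (dual_algebra A) (\<lambda>x. (x, d x))"
  using derivation_one[OF assms] is_derivationD[OF assms(2)]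
  by (auto simp: alg_hom_def dual_simps)

lemma derivation_unique:
  assumes d: "is_derivation (CatLoc hb) d" and d': "is_derivation (CatLoc hb) d'"
    and eq: "d (elt hb GU) = d' (elt hb GU)" "d (elt hb GR) = d' (elt hb GR)"
      "d (elt hb GW) = d' (elt hb GW)"
    and X: "X \<in> carrier (CatLoc hb)"
  shows "d X = d' X"
  using cat_loc_hom_unique[OF dual_cx_algebra[OF CatLoc_cx_algebra]
      derivation_hom[OF CatLoc_cx_algebra d] derivation_hom[OF CatLoc_cx_algebra d'] _ _ _ X] eq
  by simp

lemma derivation_ext:
  assumes "d \<in> extensional (carrier (CatLoc hb))" "d' \<in> extensional (carrier (CatLoc hb))"
    and "is_derivation (CatLoc hb) d" "is_derivation (CatLoc hb) d'"
    and "d (elt hb GU) = d' (elt hb GU)" "d (elt hb GR) = d' (elt hb GR)"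
      "d (elt hb GW) = d' (elt hb GW)"
  shows "d = d'"
  by (rule extensionalityI[OF assms(1,2)]) (rule derivation_unique[OF assms(3-7)])

lemma derivation_exists:
  assumes cl: "u \<in> carrier (CatLoc hb)" "r \<in> carrier (CatLoc hb)" "w \<in> carrier (CatLoc hb)"
    and ru: "elt hb GR \<otimes>\<^bsub>CatLoc hb\<^esub> u \<oplus>\<^bsub>CatLoc hb\<^esub> r \<otimes>\<^bsub>CatLoc hb\<^esub> elt hb GU =
      elt hb GU \<otimes>\<^bsub>CatLoc hb\<^esub> r \<oplus>\<^bsub>CatLoc hb\<^esub> u \<otimes>\<^bsub>CatLoc hb\<^esub> elt hb GR"
    and wr: "elt hb GW \<otimes>\<^bsub>CatLoc hb\<^esub> r \<oplus>\<^bsub>CatLoc hb\<^esub> w \<otimes>\<^bsub>CatLoc hb\<^esub> elt hb GR =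
      exp (of_real hb) \<odot>\<^bsub>CatLoc hb\<^esub>
        (elt hb GR \<otimes>\<^bsub>CatLoc hb\<^esub> w \<oplus>\<^bsub>CatLoc hb\<^esub> r \<otimes>\<^bsub>CatLoc hb\<^esub> elt hb GW)"
    and wu: "elt hb GW \<otimes>\<^bsub>CatLoc hb\<^esub> u \<oplus>\<^bsub>CatLoc hb\<^esub> w \<otimes>\<^bsub>CatLoc hb\<^esub> elt hb GU =
      (elt hb GU \<otimes>\<^bsub>CatLoc hb\<^esub> w \<oplus>\<^bsub>CatLoc hb\<^esub> u \<otimes>\<^bsub>CatLoc hb\<^esub> elt hb GW)
        \<oplus>\<^bsub>CatLoc hb\<^esub> of_real hb \<odot>\<^bsub>CatLoc hb\<^esub> w"
  shows "\<exists>d. d \<in> extensional (carrier (CatLoc hb)) \<and> is_derivation (CatLoc hb) d \<and>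
    d (elt hb GU) = u \<and> d (elt hb GR) = r \<and> d (elt hb GW) = w"
proof -
  let ?L = "CatLoc hb" and ?D = "dual_algebra (CatLoc hb)"
  interpret L: cx_algebra ?L by (rule CatLoc_cx_algebra)
  have D: "cx_algebra ?D" by (rule dual_cx_algebra[OF CatLoc_cx_algebra])
  have fst_hom: "alg_hom ?D ?L fst" by (auto simp: alg_hom_def dual_simps)
  note cls = cl elt_closed[of hb]
  obtain F where F: "alg_hom (Cat hb) ?D F" "F (cat_elt hb GU) = (elt hb GU, u)"
    "F (cat_elt hb GR) = (elt hb GR, r)" "F (cat_elt hb GW) = (elt hb GW, w)"
  proof -
    have "\<exists>F. alg_hom (Cat hb) ?D F \<and> F (cat_elt hb GU) = (elt hb GU, u) \<and>
      F (cat_elt hb GR) = (elt hb GR, r) \<and> F (cat_elt hb GW) = (elt hb GW, w) \<and>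
      F (cat_elt hb GRi) = inv\<^bsub>?D\<^esub> (elt hb GR, r) \<and> F (cat_elt hb GWi) = inv\<^bsub>?D\<^esub> (elt hb GW, w)"
      using cls ru wr wu
      by (intro cat_universal[OF D] dual_Units[OF CatLoc_cx_algebra] elt_Units)
        (simp_all add: dual_simps elt_relations L.a_comm)
    then show ?thesis using that by blast
  qed
  have fstF: "fst (F X) = loc_map (Cat hb) (Z_plus hb) X" if "X \<in> carrier (Cat hb)" for X
    using cat_hom_unique[OF CatLoc_cx_algebra alg_hom_comp[OF F(1) fst_hom] cat_loc_map_hom _ _ _ that]
    by (simp add: F elt_def)
  have "F p \<in> Units ?D" if p: "p \<in> Z_plus hb" for p
  proof -
    have pc: "p \<in> carrier (Cat hb)" using p Z_plus_carrier by blast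
    have "fst (F p) \<in> Units ?L"
      using loc_map_Units(1)[OF Z_plus_carrier p] fstF[OF pc] by (simp add: CatLoc_def)
    moreover have "snd (F p) \<in> carrier ?L"
      using alg_homD(1)[OF F(1) pc] by (auto simp: dual_simps)
    ultimately show ?thesis using dual_Units[OF CatLoc_cx_algebra] by (metis prod.collapse)
  qed
  from cat_loc_universal[OF D F(1) this] obtain H where
    H: "alg_hom ?L ?D H" "\<And>g. H (elt hb g) = F (cat_elt hb g)" by blast
  have id: "alg_hom ?L ?L (\<lambda>x. x)" by (simp add: alg_hom_def)
  have fstH: "fst (H X) = X" if "X \<in> carrier ?L" for X
    using cat_loc_hom_unique[OF CatLoc_cx_algebra alg_hom_comp[OF H(1) fst_hom] id _ _ _ that]
    by (simp add: F H)
  then have HX: "H X = (X, snd (H X))" if "X \<in> carrier ?L" for X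
    using that by (metis prod.collapse)
  define d where "d = (\<lambda>X \<in> carrier ?L. snd (H X))"
  have HX: "H X = (X, d X)" if "X \<in> carrier ?L" for X
    using HX[OF that] that by (simp add: d_def)
  note h = alg_homD[OF H(1)]
  have "is_derivation ?L d"
    unfolding is_derivation_def
  proof (intro conjI ballI allI)
    fix x y c assume x: "x \<in> carrier ?L" and y: "y \<in> carrier ?L"
    show "d (x \<oplus>\<^bsub>?L\<^esub> y) = d x \<oplus>\<^bsub>?L\<^esub> d y" using h(2)[OF x y] x y by (simp add: HX dual_simps)
    show "d (x \<otimes>\<^bsub>?L\<^esub> y) = d x \<otimes>\<^bsub>?L\<^esub> y \<oplus>\<^bsub>?L\<^esub> x \<otimes>\<^bsub>?L\<^esub> d y"
      using h(3)[OF x y] x y by (simp add: HX dual_simps)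
  next
    fix x c assume x: "x \<in> carrier ?L"
    show "d x \<in> carrier ?L" using h(1)[OF x] x by (simp add: HX dual_simps)
    show "d (c \<odot>\<^bsub>?L\<^esub> x) = c \<odot>\<^bsub>?L\<^esub> d x"
      using h(4)[OF x, of c] x by (simp add: HX dual_simps L.smult_closed)
  qed
  moreover have "d (elt hb GU) = u" "d (elt hb GR) = r" "d (elt hb GW) = w"
    using HX[OF elt_closed] H(2) F by (metis prod.inject)+
  moreover have "d \<in> extensional (carrier ?L)" by (simp add: d_def)
  ultimately show ?thesis by blast
qed

lemma is_del_u_del_u: "is_del_u hb (del_u hb)"
proof -
  interpret L: cx_algebra "CatLoc hb" by (rule CatLoc_cx_algebra)
  have "\<exists>d. d \<in> extensional (carrier (CatLoc hb)) \<and> is_derivation (CatLoc hb) d \<and>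
    d (elt hb GU) = \<one>\<^bsub>CatLoc hb\<^esub> \<and> d (elt hb GR) = elt hb GR \<and> d (elt hb GW) = \<zero>\<^bsub>CatLoc hb\<^esub>"
    by (rule derivation_exists)
      (simp_all add: elt_closed elt_relations L.smult_closed L.smult_zero L.a_comm)
  then have "\<exists>!d. is_del_u hb d"
    unfolding is_del_u_def
    by (rule ex_ex1I) (rule derivation_ext[where hb = hb]; simp)
  then show ?thesis unfolding del_u_def by (rule theI')
qed

lemma is_del_v_del_v: "is_del_v hb (del_v hb)"
proof -
  interpret L: cx_algebra "CatLoc hb" by (rule CatLoc_cx_algebra)
  have c: "a \<odot>\<^bsub>CatLoc hb\<^esub> (b \<odot>\<^bsub>CatLoc hb\<^esub> x) = b \<odot>\<^bsub>CatLoc hb\<^esub> (a \<odot>\<^bsub>CatLoc hb\<^esub> x)"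
    if "x \<in> carrier (CatLoc hb)" for a b x
    using that by (metis L.smult_smult mult.commute)
  have "\<exists>d. d \<in> extensional (carrier (CatLoc hb)) \<and> is_derivation (CatLoc hb) d \<and>
    d (elt hb GU) = \<zero>\<^bsub>CatLoc hb\<^esub> \<and> d (elt hb GR) = \<zero>\<^bsub>CatLoc hb\<^esub> \<and>
    d (elt hb GW) = \<i> \<odot>\<^bsub>CatLoc hb\<^esub> elt hb GW"
    by (rule derivation_exists)
      (simp_all add: elt_closed elt_relations L.smult_closed L.smult_mult_l L.smult_mult_r
        L.smult_r_distr c[of _ \<i>])
  then have "\<exists>!d. is_del_v hb d"
    unfolding is_del_v_def
    by (rule ex_ex1I) (rule derivation_ext[where hb = hb]; simp)
  then show ?thesis unfolding del_v_def by (rule theI')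
qed

section \<open>Existence and uniqueness of the involution\<close>

definition conj_opposite :: "(complex, 'a) module \<Rightarrow> (complex, 'a) module" where
  "conj_opposite A = A\<lparr>monoid.mult := (\<lambda>x y. y \<otimes>\<^bsub>A\<^esub> x), smult := (\<lambda>c x. cnj c \<odot>\<^bsub>A\<^esub> x)\<rparr>"

lemma conj_opposite_simps:
  "carrier (conj_opposite A) = carrier A"
  "x \<otimes>\<^bsub>conj_opposite A\<^esub> y = y \<otimes>\<^bsub>A\<^esub> x"
  "\<one>\<^bsub>conj_opposite A\<^esub> = \<one>\<^bsub>A\<^esub>"
  "\<zero>\<^bsub>conj_opposite A\<^esub> = \<zero>\<^bsub>A\<^esub>"
  "x \<oplus>\<^bsub>conj_opposite A\<^esub> y = x \<oplus>\<^bsub>A\<^esub> y"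
  "c \<odot>\<^bsub>conj_opposite A\<^esub> x = cnj c \<odot>\<^bsub>A\<^esub> x"
  by (simp_all add: conj_opposite_def)

lemma conj_opposite_cx_algebra:
  assumes "cx_algebra A" shows "cx_algebra (conj_opposite A)"
proof -
  interpret A: cx_algebra A by fact
  have ag: "abelian_group (conj_opposite A)"
  proof (rule abelian_groupI)
    fix x assume "x \<in> carrier (conj_opposite A)"
    then show "\<exists>y\<in>carrier (conj_opposite A). y \<oplus>\<^bsub>conj_opposite A\<^esub> x = \<zero>\<^bsub>conj_opposite A\<^esub>"
      by (intro bexI[of _ "\<ominus>\<^bsub>A\<^esub> x"]) (auto simp: conj_opposite_simps A.l_neg)
  qed (auto simp: conj_opposite_simps A.a_ac)
  have mo: "Group.monoid (conj_opposite A)"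
    by (rule monoidI) (auto simp: conj_opposite_simps A.m_assoc)
  interpret D: ring "conj_opposite A"
    by (rule ringI[OF ag mo]) (auto simp: conj_opposite_simps A.l_distr A.r_distr)
  show ?thesis
    by unfold_locales
      (auto simp: conj_opposite_simps A.smult_closed A.smult_l_distr A.smult_r_distr A.smult_smult
        A.smult_one A.smult_mult_l A.smult_mult_r)
qed

lemma conj_opposite_Units: "Units (conj_opposite A) = Units A"
  by (auto simp: Units_def conj_opposite_simps)

lemma conj_opposite_hom:
  "alg_hom A B f \<Longrightarrow> alg_hom (conj_opposite A) (conj_opposite B) f"
  by (simp add: alg_hom_def conj_opposite_simps)

lemma conj_opposite_twice: "alg_hom A (conj_opposite (conj_opposite B)) f \<longleftrightarrow> alg_hom A B f"
  by (simp add: alg_hom_def conj_opposite_simps)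

lemma cat_phi_hom:
  assumes "x \<in> Z_UR hb" "y \<in> Z_UR hb"
  shows "cat_phi hb (x \<otimes>\<^bsub>Cat hb\<^esub> y) = (\<lambda>u. cat_phi hb x u * cat_phi hb y u)"
    and "cat_phi hb (x \<oplus>\<^bsub>Cat hb\<^esub> y) = (\<lambda>u. cat_phi hb x u + cat_phi hb y u)"
    and "cat_phi hb (c \<odot>\<^bsub>Cat hb\<^esub> x) = (\<lambda>u. c * cat_phi hb x u)"
    and "cat_phi hb \<one>\<^bsub>Cat hb\<^esub> = (\<lambda>u. 1)"
    and "cat_phi hb (cat_elt hb GU) = (\<lambda>u. of_real u)"
    and "cat_phi hb (cat_elt hb GR) = (\<lambda>u. of_real (exp u))"
    and "cat_phi hb (cat_elt hb GRi) = (\<lambda>u. of_real (exp (- u)))"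
  using is_cat_phi_cat_phi[of hb] assms
  by (simp_all add: is_cat_phi_def alg_hom_def smooth_algebra_def)

lemma cat_star_on_Z_UR:
  assumes F: "alg_hom (Cat hb) (conj_opposite (CatLoc hb)) F"
    and FU: "F (cat_elt hb GU) = elt hb GU" and FR: "F (cat_elt hb GR) = elt hb GR"
    and FRi: "F (cat_elt hb GRi) = elt hb GRi"
    and z: "z \<in> Z_UR hb"
  shows "\<exists>z' \<in> Z_UR hb. F z = loc_map (Cat hb) (Z_plus hb) z' \<and>
    cat_phi hb z' = (\<lambda>u. cnj (cat_phi hb z u))"
proof -
  interpret C: cx_algebra "Cat hb" by (rule Cat_cx_algebra)
  have car: "z \<in> carrier (Cat hb)" if "z \<in> Z_UR hb" for z using that Z_UR_carrier by blast
  note f = alg_homD[OF F, unfolded conj_opposite_simps]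
  note l = alg_homD[OF cat_loc_map_hom[of hb]]
  note phi1 = cat_phi_hom(4-7)[OF Z_UR_closed(1) Z_UR_closed(1)]
  from z show ?thesis unfolding Z_UR_def
  proof (induction rule: gen_subalg.induct)
    case (sub_gen z)
    then consider "z = cat_elt hb GU" | "z = cat_elt hb GR" | "z = cat_elt hb GRi" by blast
    then show ?case unfolding Z_UR_def[symmetric]
      by cases (rule bexI[of _ z], simp_all add: FU FR FRi elt_def phi1 Z_UR_closed)+
  next
    case sub_one
    show ?case unfolding Z_UR_def[symmetric]
      by (rule bexI[of _ "\<one>\<^bsub>Cat hb\<^esub>"]) (simp_all add: f l phi1 Z_UR_closed)
  next
    case (sub_smult x c)
    note IH = sub_smult[unfolded Z_UR_def[symmetric]]
    then obtain x' where "x' \<in> Z_UR hb" "F x = loc_map (Cat hb) (Z_plus hb) x'"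
      "cat_phi hb x' = (\<lambda>u. cnj (cat_phi hb x u))" by blast
    then show ?case unfolding Z_UR_def[symmetric] using IH(1)
      by (intro bexI[of _ "cnj c \<odot>\<^bsub>Cat hb\<^esub> x'"]) (simp_all add: f l car cat_phi_hom(3) Z_UR_closed)
  next
    case (sub_add x y)
    note IH = sub_add[unfolded Z_UR_def[symmetric]]
    then obtain x' y' where "x' \<in> Z_UR hb" "F x = loc_map (Cat hb) (Z_plus hb) x'"
      "cat_phi hb x' = (\<lambda>u. cnj (cat_phi hb x u))" "y' \<in> Z_UR hb"
      "F y = loc_map (Cat hb) (Z_plus hb) y'" "cat_phi hb y' = (\<lambda>u. cnj (cat_phi hb y u))" by blast
    then show ?case unfolding Z_UR_def[symmetric] using IH(1,2)
      by (intro bexI[of _ "x' \<oplus>\<^bsub>Cat hb\<^esub> y'"]) (simp_all add: f l car cat_phi_hom(2) Z_UR_closed)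
  next
    case (sub_mult x y)
    note IH = sub_mult[unfolded Z_UR_def[symmetric]]
    then obtain x' y' where "x' \<in> Z_UR hb" "F x = loc_map (Cat hb) (Z_plus hb) x'"
      "cat_phi hb x' = (\<lambda>u. cnj (cat_phi hb x u))" "y' \<in> Z_UR hb"
      "F y = loc_map (Cat hb) (Z_plus hb) y'" "cat_phi hb y' = (\<lambda>u. cnj (cat_phi hb y u))" by blast
    then show ?case unfolding Z_UR_def[symmetric] using IH(1,2)
      by (intro bexI[of _ "y' \<otimes>\<^bsub>Cat hb\<^esub> x'"])
        (simp_all add: f l car cat_phi_hom(1) Z_UR_closed mult.commute)
  qed
qed

lemma involution_one:
  assumes "cx_algebra A" "is_involution A s" shows "s \<one>\<^bsub>A\<^esub> = \<one>\<^bsub>A\<^esub>"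
proof -
  interpret A: cx_algebra A by fact
  have s: "s \<one>\<^bsub>A\<^esub> \<in> carrier A" "s (s \<one>\<^bsub>A\<^esub>) = \<one>\<^bsub>A\<^esub>"
    "\<And>x y. x \<in> carrier A \<Longrightarrow> y \<in> carrier A \<Longrightarrow> s (x \<otimes>\<^bsub>A\<^esub> y) = s y \<otimes>\<^bsub>A\<^esub> s x"
    using assms(2) by (auto simp: is_involution_def)
  have "s (s \<one>\<^bsub>A\<^esub> \<otimes>\<^bsub>A\<^esub> \<one>\<^bsub>A\<^esub>) = s \<one>\<^bsub>A\<^esub> \<otimes>\<^bsub>A\<^esub> s (s \<one>\<^bsub>A\<^esub>)" using s(1) by (intro s(3)) auto
  then show ?thesis using s(1,2) by simp
qed

lemma involution_hom:
  assumes "cx_algebra A" "is_involution A s" shows "alg_hom A (conj_opposite A) s"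
  using assms(2) involution_one[OF assms] by (auto simp: is_involution_def alg_hom_def conj_opposite_simps)

lemma cnj_exp_of_real: "cnj (exp (complex_of_real x)) = exp (of_real x)"
  by (metis complex_cnj_complex_of_real exp_of_real)

lemma is_cat_star_exists: "\<exists>s. is_cat_star hb s"
proof -
  let ?L = "CatLoc hb" and ?O = "conj_opposite (CatLoc hb)"
  interpret L: cx_algebra ?L by (rule CatLoc_cx_algebra)
  have O: "cx_algebra ?O" by (rule conj_opposite_cx_algebra[OF CatLoc_cx_algebra])
  interpret O: cx_algebra ?O by (rule O)
  have u: "elt hb GR \<in> Units ?O" "elt hb GWi \<in> Units ?O"
    unfolding conj_opposite_Units
    using elt_relations(1-4)[of hb] by (auto simp: Units_def elt_closed intro!: bexI)
  have i: "inv\<^bsub>?O\<^esub> (elt hb GR) = elt hb GRi" "inv\<^bsub>?O\<^esub> (elt hb GWi) = elt hb GW"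
    using O.inv_unique'[of "elt hb GR" "elt hb GRi"] O.inv_unique'[of "elt hb GWi" "elt hb GW"]
      elt_relations elt_closed by (simp_all add: conj_opposite_simps)
  obtain G where G: "alg_hom (Cat hb) ?L G" "G (cat_elt hb GU) = elt hb GU"
    "G (cat_elt hb GR) = elt hb GR" "G (cat_elt hb GW) = elt hb GW"
    "G (cat_elt hb GRi) = elt hb GRi" "G (cat_elt hb GWi) = elt hb GWi"
    using cat_loc_map_hom by (auto simp: elt_def)
  let ?W = "elt hb GW" and ?Wi = "elt hb GWi" and ?U = "elt hb GU" and ?R = "elt hb GR"
  have rel: "term_class UNIV (cat_rels hb) (Mul (Gen GWi) (Gen GR)) =
      term_class UNIV (cat_rels hb) (Mul (Cst (exp (- of_real hb))) (Mul (Gen GR) (Gen GWi)))"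
    "term_class UNIV (cat_rels hb) (Mul (Gen GWi) (Gen GU)) =
      term_class UNIV (cat_rels hb) (Add (Mul (Gen GU) (Gen GWi)) (Mul (Cst (- of_real hb)) (Gen GWi)))"
    by (rule cat_rel_eq; simp add: cat_rels_def Let_def)+
  have rel': "cat_elt hb GWi \<otimes>\<^bsub>Cat hb\<^esub> cat_elt hb GR =
      exp (- of_real hb) \<odot>\<^bsub>Cat hb\<^esub> (cat_elt hb GR \<otimes>\<^bsub>Cat hb\<^esub> cat_elt hb GWi)"
    "cat_elt hb GWi \<otimes>\<^bsub>Cat hb\<^esub> cat_elt hb GU =
      cat_elt hb GU \<otimes>\<^bsub>Cat hb\<^esub> cat_elt hb GWi \<oplus>\<^bsub>Cat hb\<^esub> (- of_real hb) \<odot>\<^bsub>Cat hb\<^esub> cat_elt hb GWi"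
    using rel by (simp_all add: Cat_def cat_elt_def presented_ops presented_smult)
  interpret C: cx_algebra "Cat hb" by (rule Cat_cx_algebra)
  note r = rel'[THEN arg_cong[where f = G]]
  note g = alg_homD[OF G(1)]
  have wr: "?Wi \<otimes>\<^bsub>?L\<^esub> ?R = exp (- of_real hb) \<odot>\<^bsub>?L\<^esub> (?R \<otimes>\<^bsub>?L\<^esub> ?Wi)"
    and wu: "?Wi \<otimes>\<^bsub>?L\<^esub> ?U = ?U \<otimes>\<^bsub>?L\<^esub> ?Wi \<oplus>\<^bsub>?L\<^esub> (- of_real hb) \<odot>\<^bsub>?L\<^esub> ?Wi"
    using r by (simp_all add: g G C.smult_closed cat_elt_closed)
  have rw: "?R \<otimes>\<^bsub>?L\<^esub> ?Wi = exp (of_real hb) \<odot>\<^bsub>?L\<^esub> (?Wi \<otimes>\<^bsub>?L\<^esub> ?R)"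
    by (simp add: wr L.smult_smult[symmetric] L.smult_one elt_closed exp_minus)
  have uw: "?U \<otimes>\<^bsub>?L\<^esub> ?Wi = ?Wi \<otimes>\<^bsub>?L\<^esub> ?U \<oplus>\<^bsub>?L\<^esub> of_real hb \<odot>\<^bsub>?L\<^esub> ?Wi"
    by (simp add: wu L.a_assoc L.smult_closed L.smult_l_distr[symmetric] L.smult_zero_scalar elt_closed)
  have "\<exists>F. alg_hom (Cat hb) ?O F \<and> F (cat_elt hb GU) = ?U \<and> F (cat_elt hb GR) = ?R \<and>
    F (cat_elt hb GW) = ?Wi \<and> F (cat_elt hb GRi) = inv\<^bsub>?O\<^esub> ?R \<and> F (cat_elt hb GWi) = inv\<^bsub>?O\<^esub> ?Wi"
    by (rule cat_universal[OF O _ u])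
      (use rw uw in \<open>simp_all add: conj_opposite_simps elt_closed elt_relations cnj_exp_of_real\<close>)
  then obtain F where F: "alg_hom (Cat hb) ?O F" "F (cat_elt hb GU) = ?U" "F (cat_elt hb GR) = ?R"
    "F (cat_elt hb GW) = ?Wi" "F (cat_elt hb GRi) = elt hb GRi" "F (cat_elt hb GWi) = ?W"
    unfolding i by blast
  have "F p \<in> Units ?O" if p: "p \<in> Z_plus hb" for p
  proof -
    have "p \<in> Z_UR hb" using p by (simp add: Z_plus_def)
    then obtain p' where "p' \<in> Z_UR hb" "F p = loc_map (Cat hb) (Z_plus hb) p'"
      "cat_phi hb p' = (\<lambda>u. cnj (cat_phi hb p u))"
      using cat_star_on_Z_UR[OF F(1,2,3,5)] by blast
    moreover from this have "p' \<in> Z_plus hb" using p by (simp add: Z_plus_def)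
    ultimately show ?thesis
      using loc_map_Units(1)[OF Z_plus_carrier] by (simp add: conj_opposite_Units CatLoc_def)
  qed
  from cat_loc_universal[OF O F(1) this] obtain H where
    H: "alg_hom ?L ?O H" "\<And>g. H (elt hb g) = F (cat_elt hb g)" by blast
  have HH: "alg_hom ?L ?L (\<lambda>x. H (H x))"
    using alg_hom_comp[OF H(1) conj_opposite_hom[OF H(1)]] by (simp add: conj_opposite_twice)
  have id: "alg_hom ?L ?L (\<lambda>x. x)" by (simp add: alg_hom_def)
  have inv: "H (H X) = X" if "X \<in> carrier ?L" for X
    using cat_loc_hom_unique[OF CatLoc_cx_algebra HH id _ _ _ that] by (simp add: H F)
  note h = alg_homD[OF H(1), unfolded conj_opposite_simps]
  have "is_cat_star hb (\<lambda>x \<in> carrier ?L. H x)"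
    unfolding is_cat_star_def is_involution_def
    by (auto simp: h inv L.smult_closed elt_closed H F)
  then show ?thesis by blast
qed

lemma is_cat_star_unique:
  assumes "is_cat_star hb s" "is_cat_star hb s'" shows "s = s'"
proof (rule extensionalityI)
  show "s \<in> extensional (carrier (CatLoc hb))" "s' \<in> extensional (carrier (CatLoc hb))"
    using assms by (auto simp: is_cat_star_def)
  fix X assume X: "X \<in> carrier (CatLoc hb)"
  have "is_involution (CatLoc hb) s" "is_involution (CatLoc hb) s'"
    using assms by (auto simp: is_cat_star_def)
  then show "s X = s' X"
    using cat_loc_hom_unique[OF conj_opposite_cx_algebra[OF CatLoc_cx_algebra]
        involution_hom[OF CatLoc_cx_algebra] involution_hom[OF CatLoc_cx_algebra] _ _ _ X] assms
    by (simp add: is_cat_star_def)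
qed

lemma is_cat_star_cat_star: "is_cat_star hb (cat_star hb)"
  unfolding cat_star_def
  using theI'[of "is_cat_star hb"] is_cat_star_exists is_cat_star_unique by blast

section \<open>The derivations are hermitian and commute\<close>

lemma del_uD:
  "del_u hb \<in> extensional (carrier (CatLoc hb))" "is_derivation (CatLoc hb) (del_u hb)"
  "del_u hb (elt hb GU) = \<one>\<^bsub>CatLoc hb\<^esub>" "del_u hb (elt hb GR) = elt hb GR"
  "del_u hb (elt hb GW) = \<zero>\<^bsub>CatLoc hb\<^esub>"
  using is_del_u_del_u[of hb] by (auto simp: is_del_u_def)

lemma del_vD:
  "del_v hb \<in> extensional (carrier (CatLoc hb))" "is_derivation (CatLoc hb) (del_v hb)"
  "del_v hb (elt hb GU) = \<zero>\<^bsub>CatLoc hb\<^esub>" "del_v hb (elt hb GR) = \<zero>\<^bsub>CatLoc hb\<^esub>"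
  "del_v hb (elt hb GW) = \<i> \<odot>\<^bsub>CatLoc hb\<^esub> elt hb GW"
  using is_del_v_del_v[of hb] by (auto simp: is_del_v_def)

lemma cat_starD:
  "x \<in> carrier (CatLoc hb) \<Longrightarrow> cat_star hb x \<in> carrier (CatLoc hb)"
  "x \<in> carrier (CatLoc hb) \<Longrightarrow> y \<in> carrier (CatLoc hb) \<Longrightarrow>
    cat_star hb (x \<oplus>\<^bsub>CatLoc hb\<^esub> y) = cat_star hb x \<oplus>\<^bsub>CatLoc hb\<^esub> cat_star hb y"
  "x \<in> carrier (CatLoc hb) \<Longrightarrow> cat_star hb (c \<odot>\<^bsub>CatLoc hb\<^esub> x) = cnj c \<odot>\<^bsub>CatLoc hb\<^esub> cat_star hb x"
  "x \<in> carrier (CatLoc hb) \<Longrightarrow> y \<in> carrier (CatLoc hb) \<Longrightarrow>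
    cat_star hb (x \<otimes>\<^bsub>CatLoc hb\<^esub> y) = cat_star hb y \<otimes>\<^bsub>CatLoc hb\<^esub> cat_star hb x"
  "x \<in> carrier (CatLoc hb) \<Longrightarrow> cat_star hb (cat_star hb x) = x"
  "cat_star hb (elt hb GU) = elt hb GU" "cat_star hb (elt hb GR) = elt hb GR"
  "cat_star hb (elt hb GW) = elt hb GWi" "cat_star hb (elt hb GWi) = elt hb GW"
proof -
  have s: "is_involution (CatLoc hb) (cat_star hb)" "cat_star hb (elt hb GU) = elt hb GU"
    "cat_star hb (elt hb GR) = elt hb GR" "cat_star hb (elt hb GW) = elt hb GWi"
    using is_cat_star_cat_star by (auto simp: is_cat_star_def)
  show "cat_star hb (elt hb GU) = elt hb GU" "cat_star hb (elt hb GR) = elt hb GR"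
    "cat_star hb (elt hb GW) = elt hb GWi" by fact+
  show inv: "x \<in> carrier (CatLoc hb) \<Longrightarrow> cat_star hb (cat_star hb x) = x" for x
    using s(1) by (simp add: is_involution_def)
  show "cat_star hb (elt hb GWi) = elt hb GW" using inv[OF elt_closed[of hb GW]] s(4) by simp
qed (use is_cat_star_cat_star[of hb] in \<open>auto simp: is_cat_star_def is_involution_def\<close>)

lemma derivation_GWi:
  assumes d: "is_derivation (CatLoc hb) d"
  shows "d (elt hb GWi) =
    \<ominus>\<^bsub>CatLoc hb\<^esub> (elt hb GWi \<otimes>\<^bsub>CatLoc hb\<^esub> (d (elt hb GW) \<otimes>\<^bsub>CatLoc hb\<^esub> elt hb GWi))"
proof -
  interpret L: cx_algebra "CatLoc hb" by (rule CatLoc_cx_algebra)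
  let ?L = "CatLoc hb" and ?W = "elt hb GW" and ?V = "elt hb GWi"
  have cl: "?W \<in> carrier ?L" "?V \<in> carrier ?L" "d ?W \<in> carrier ?L" "d ?V \<in> carrier ?L"
    using is_derivationD(1)[OF d] elt_closed by auto
  have "d (?W \<otimes>\<^bsub>?L\<^esub> ?V) = \<zero>\<^bsub>?L\<^esub>"
    by (simp add: elt_relations derivation_one[OF CatLoc_cx_algebra d])
  then have "?V \<otimes>\<^bsub>?L\<^esub> (d ?W \<otimes>\<^bsub>?L\<^esub> ?V \<oplus>\<^bsub>?L\<^esub> ?W \<otimes>\<^bsub>?L\<^esub> d ?V) = \<zero>\<^bsub>?L\<^esub>"
    using cl by (simp add: is_derivationD(4)[OF d])
  moreover have "?V \<otimes>\<^bsub>?L\<^esub> (?W \<otimes>\<^bsub>?L\<^esub> d ?V) = d ?V"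
    using cl by (simp add: L.m_assoc[symmetric] elt_relations)
  ultimately have "d ?V \<oplus>\<^bsub>?L\<^esub> ?V \<otimes>\<^bsub>?L\<^esub> (d ?W \<otimes>\<^bsub>?L\<^esub> ?V) = \<zero>\<^bsub>?L\<^esub>"
    using cl by (simp add: L.r_distr L.a_comm)
  then show ?thesis using cl by (simp add: L.minus_equality)
qed

lemma star_derivation:
  assumes d: "is_derivation (CatLoc hb) d"
  shows "is_derivation (CatLoc hb) (\<lambda>x. cat_star hb (d (cat_star hb x)))"
proof -
  interpret L: cx_algebra "CatLoc hb" by (rule CatLoc_cx_algebra)
  note sd = cat_starD[where hb = hb] is_derivationD[OF d]
  show ?thesis
    unfolding is_derivation_def by (auto simp: sd L.a_comm)
qed

lemma del_u_hermitian:
  assumes "x \<in> carrier (CatLoc hb)"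
  shows "del_u hb (cat_star hb x) = cat_star hb (del_u hb x)"
proof -
  interpret L: cx_algebra "CatLoc hb" by (rule CatLoc_cx_algebra)
  note d = del_uD(2)[of hb]
  have "cat_star hb (0 \<odot>\<^bsub>CatLoc hb\<^esub> \<one>\<^bsub>CatLoc hb\<^esub>) = \<zero>\<^bsub>CatLoc hb\<^esub>"
    by (simp only: cat_starD L.one_closed complex_cnj_zero) (simp add: L.smult_zero_scalar cat_starD)
  then have z: "cat_star hb \<zero>\<^bsub>CatLoc hb\<^esub> = \<zero>\<^bsub>CatLoc hb\<^esub>" by (simp add: L.smult_zero_scalar)
  have o: "cat_star hb \<one>\<^bsub>CatLoc hb\<^esub> = \<one>\<^bsub>CatLoc hb\<^esub>"
    using is_cat_star_cat_star[of hb] involution_one[OF CatLoc_cx_algebra]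
    by (simp add: is_cat_star_def)
  have "cat_star hb (del_u hb (cat_star hb (cat_star hb x))) = del_u hb (cat_star hb x)"
    by (rule derivation_unique[OF star_derivation[OF d] d, of "cat_star hb x"])
      (use assms in \<open>simp_all add: cat_starD del_uD derivation_GWi[OF d] elt_closed z o\<close>)
  then show ?thesis using assms by (simp add: cat_starD)
qed

lemma del_v_hermitian:
  assumes "x \<in> carrier (CatLoc hb)"
  shows "del_v hb (cat_star hb x) = cat_star hb (del_v hb x)"
proof -
  interpret L: cx_algebra "CatLoc hb" by (rule CatLoc_cx_algebra)
  note d = del_vD(2)[of hb]
  have "cat_star hb (0 \<odot>\<^bsub>CatLoc hb\<^esub> \<one>\<^bsub>CatLoc hb\<^esub>) = \<zero>\<^bsub>CatLoc hb\<^esub>"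
    by (simp only: cat_starD L.one_closed complex_cnj_zero) (simp add: L.smult_zero_scalar cat_starD)
  then have z: "cat_star hb \<zero>\<^bsub>CatLoc hb\<^esub> = \<zero>\<^bsub>CatLoc hb\<^esub>" by (simp add: L.smult_zero_scalar)
  have v: "del_v hb (elt hb GWi) = (- \<i>) \<odot>\<^bsub>CatLoc hb\<^esub> elt hb GWi"
  proof -
    have "del_v hb (elt hb GWi) = (- 1) \<odot>\<^bsub>CatLoc hb\<^esub> (\<i> \<odot>\<^bsub>CatLoc hb\<^esub> elt hb GWi)"
      by (simp add: derivation_GWi[OF d] del_vD L.smult_mult_l L.smult_mult_r elt_relations elt_closed
        L.smult_minus_one L.smult_closed)
    then show ?thesis by (simp add: L.smult_smult[symmetric] elt_closed)
  qed
  have "cat_star hb (del_v hb (cat_star hb (cat_star hb x))) = del_v hb (cat_star hb x)"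
    by (rule derivation_unique[OF star_derivation[OF d] d, of "cat_star hb x"])
      (use assms in \<open>simp_all add: cat_starD del_vD v elt_closed z\<close>)
  then show ?thesis using assms by (simp add: cat_starD)
qed

lemma derivation_commutator:
  assumes A: "cx_algebra A" and d: "is_derivation A d" and e: "is_derivation A e"
  shows "is_derivation A (\<lambda>x. d (e x) \<ominus>\<^bsub>A\<^esub> e (d x))"
proof -
  interpret A: cx_algebra A by fact
  note dd = is_derivationD[OF d] and ee = is_derivationD[OF e]
  have canc: "(a \<oplus>\<^bsub>A\<^esub> (b \<oplus>\<^bsub>A\<^esub> (c \<oplus>\<^bsub>A\<^esub> f))) \<ominus>\<^bsub>A\<^esub> (a' \<oplus>\<^bsub>A\<^esub> (c \<oplus>\<^bsub>A\<^esub> (b \<oplus>\<^bsub>A\<^esub> f'))) =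
    (a \<ominus>\<^bsub>A\<^esub> a') \<oplus>\<^bsub>A\<^esub> (f \<ominus>\<^bsub>A\<^esub> f')"
    if cl: "a \<in> carrier A" "b \<in> carrier A" "c \<in> carrier A" "f \<in> carrier A" "a' \<in> carrier A" "f' \<in> carrier A"
    for a b c f a' f'
    using that by algebra
  have add: "(a \<oplus>\<^bsub>A\<^esub> b) \<ominus>\<^bsub>A\<^esub> (c \<oplus>\<^bsub>A\<^esub> f) = (a \<ominus>\<^bsub>A\<^esub> c) \<oplus>\<^bsub>A\<^esub> (b \<ominus>\<^bsub>A\<^esub> f)"
    if "a \<in> carrier A" "b \<in> carrier A" "c \<in> carrier A" "f \<in> carrier A" for a b c f
    using that by algebra
  have sub: "(c \<odot>\<^bsub>A\<^esub> x) \<ominus>\<^bsub>A\<^esub> (c \<odot>\<^bsub>A\<^esub> y) = c \<odot>\<^bsub>A\<^esub> (x \<ominus>\<^bsub>A\<^esub> y)"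
    if "x \<in> carrier A" "y \<in> carrier A" for c x y
  proof -
    have "\<ominus>\<^bsub>A\<^esub> (c \<odot>\<^bsub>A\<^esub> y) = c \<odot>\<^bsub>A\<^esub> (\<ominus>\<^bsub>A\<^esub> y)"
      using that by (metis A.smult_closed A.smult_minus_one A.smult_smult mult.commute)
    then show ?thesis using that by (simp add: A.minus_eq A.smult_r_distr)
  qed
  show ?thesis
    unfolding is_derivation_def
  proof (intro conjI ballI allI)
    fix x y assume x: "x \<in> carrier A" and y: "y \<in> carrier A"
    show "d (e (x \<oplus>\<^bsub>A\<^esub> y)) \<ominus>\<^bsub>A\<^esub> e (d (x \<oplus>\<^bsub>A\<^esub> y)) =
      (d (e x) \<ominus>\<^bsub>A\<^esub> e (d x)) \<oplus>\<^bsub>A\<^esub> (d (e y) \<ominus>\<^bsub>A\<^esub> e (d y))"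
      using x y by (simp add: dd ee add)
    have "d (e (x \<otimes>\<^bsub>A\<^esub> y)) \<ominus>\<^bsub>A\<^esub> e (d (x \<otimes>\<^bsub>A\<^esub> y)) =
      (d (e x) \<otimes>\<^bsub>A\<^esub> y \<ominus>\<^bsub>A\<^esub> e (d x) \<otimes>\<^bsub>A\<^esub> y) \<oplus>\<^bsub>A\<^esub> (x \<otimes>\<^bsub>A\<^esub> d (e y) \<ominus>\<^bsub>A\<^esub> x \<otimes>\<^bsub>A\<^esub> e (d y))"
      using x y by (simp add: dd ee A.a_assoc canc)
    also have "\<dots> = (d (e x) \<ominus>\<^bsub>A\<^esub> e (d x)) \<otimes>\<^bsub>A\<^esub> y \<oplus>\<^bsub>A\<^esub> x \<otimes>\<^bsub>A\<^esub> (d (e y) \<ominus>\<^bsub>A\<^esub> e (d y))"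
      using x y dd(1) ee(1) by (simp add: A.minus_eq A.l_distr A.r_distr A.l_minus A.r_minus)
    finally show "d (e (x \<otimes>\<^bsub>A\<^esub> y)) \<ominus>\<^bsub>A\<^esub> e (d (x \<otimes>\<^bsub>A\<^esub> y)) =
      (d (e x) \<ominus>\<^bsub>A\<^esub> e (d x)) \<otimes>\<^bsub>A\<^esub> y \<oplus>\<^bsub>A\<^esub> x \<otimes>\<^bsub>A\<^esub> (d (e y) \<ominus>\<^bsub>A\<^esub> e (d y))" .
  qed (simp_all add: dd ee sub)
qed

lemma del_u_del_v_commute:
  assumes x: "x \<in> carrier (CatLoc hb)"
  shows "del_u hb (del_v hb x) = del_v hb (del_u hb x)"
proof -
  let ?L = "CatLoc hb"
  interpret L: cx_algebra ?L by (rule CatLoc_cx_algebra)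
  note u = is_derivationD[OF del_uD(2)[of hb]] and v = is_derivationD[OF del_vD(2)[of hb]]
  have z: "is_derivation ?L (\<lambda>x. \<zero>\<^bsub>?L\<^esub>)" by (simp add: is_derivation_def L.smult_zero)
  have z0: "d \<zero>\<^bsub>?L\<^esub> = \<zero>\<^bsub>?L\<^esub>" if "is_derivation ?L d" for d
    using is_derivationD(3)[OF that L.zero_closed, of 0] is_derivationD(1)[OF that L.zero_closed]
    by (simp add: L.smult_zero_scalar)
  note zz = z0[OF del_uD(2)] z0[OF del_vD(2)] derivation_one[OF CatLoc_cx_algebra del_vD(2)]
  have "del_u hb (del_v hb x) \<ominus>\<^bsub>?L\<^esub> del_v hb (del_u hb x) = \<zero>\<^bsub>?L\<^esub>"
    by (rule derivation_unique[OF derivation_commutator[OF CatLoc_cx_algebra del_uD(2) del_vD(2)] z _ _ _ x])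
      (simp_all add: del_uD del_vD zz u(3) elt_closed L.smult_zero L.minus_eq)
  then have "\<ominus>\<^bsub>?L\<^esub> (\<ominus>\<^bsub>?L\<^esub> del_v hb (del_u hb x)) = del_u hb (del_v hb x)"
    using x by (intro L.minus_equality) (simp_all add: L.minus_eq u(1) v(1))
  then show ?thesis using x by (simp add: u(1) v(1))
qed

section \<open>Well-typedness of the geometric data\<close>

context fixes hb :: real begin

interpretation L: cx_algebra "CatLoc hb" by (rule CatLoc_cx_algebra)

lemma del_closed: "x \<in> carrier (CatLoc hb) \<Longrightarrow> del hb x \<in> carrier (CatLoc hb)"
  "x \<in> carrier (CatLoc hb) \<Longrightarrow> delbar hb x \<in> carrier (CatLoc hb)"
  using is_derivationD(1)[OF del_uD(2)[of hb]] is_derivationD(1)[OF del_vD(2)[of hb]]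
  by (simp_all add: del_def delbar_def der_add_def der_smult_def L.smult_closed)

lemma del_lie_g: "del hb \<in> lie_g hb" "delbar hb \<in> lie_g hb"
proof -
  note u = is_derivationD(1)[OF del_uD(2)[of hb]] and v = is_derivationD(1)[OF del_vD(2)[of hb]]
  have "del hb = der_add hb (der_smult hb (1/2) (del_u hb)) (der_smult hb (- (\<i>/2)) (del_v hb))"
   "delbar hb = der_add hb (der_smult hb (1/2) (del_u hb)) (der_smult hb (\<i>/2) (del_v hb))"
    by (auto simp: del_def delbar_def der_add_def der_smult_def fun_eq_iff restrict_def u v L.smult_closed
      L.smult_r_distr L.smult_smult[symmetric])
  then show "del hb \<in> lie_g hb" "delbar hb \<in> lie_g hb" unfolding lie_g_def by blast+
qed

lemma Phi_closed: "Phi hb $ i \<in> carrier (CatLoc hb)"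
  by (simp add: Phi_def Phi1_def Phi2_def Phi3_def L.smult_closed elt_closed)
lemma Phibar_closed: "Phibar hb $ i \<in> carrier (CatLoc hb)"
  by (simp add: Phibar_def cat_starD(1) Phi_closed)

lemma Phi_VF: "Phi hb \<in> VF hb" "Phibar hb \<in> VF hb"
  unfolding VF_def mem_Collect_eq
  by (rule exI[of _ "\<one>\<^bsub>CatLoc hb\<^esub>"], rule exI[of _ "\<zero>\<^bsub>CatLoc hb\<^esub>"],
    simp add: vadd_def vmul_def vec_eq_iff Phi_closed Phibar_closed,
    rule exI[of _ "\<zero>\<^bsub>CatLoc hb\<^esub>"], rule exI[of _ "\<one>\<^bsub>CatLoc hb\<^esub>"],
    simp add: vadd_def vmul_def vec_eq_iff Phi_closed Phibar_closed)

end

end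

theory Submission
  imports Defs
begin

text \<open>Each of \<open>Phi hb\<close> and \<open>Phibar hb\<close> is annihilated by one of the
  two covariant derivatives and multiplied on the right by some \<open>a\<close> under the other. Of
  the two terms of the curvature, one is therefore the derivative of the zero field and vanishes; in
  the other, the Leibniz rule for \<open>X a\<close> loses the term with the derivative of
  \<open>X\<close> and leaves \<open>X\<close> times the derivative of \<open>a\<close>.
  \<open>curvature_half_flat\<close> carries this out.\<close>

lemma VF_closed:
  assumes "X \<in> VF hb"
  shows "X $ i \<in> carrier (CatLoc hb)"
proof -
  interpret L: cx_algebra "CatLoc hb" by (rule CatLoc_cx_algebra)
  show ?thesis
    using assms by (auto simp: VF_def vadd_def vmul_def Phi_closed Phibar_closed)
qed

text \<open>The zero field is 0 times \<open>Phi hb\<close>, so homogeneity in the vector argument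
  suffices.\<close>

lemma connection_vzero:
  assumes c: "connection hb nabla" and d: "d \<in> lie_g hb"
  shows "nabla d (vzero hb) = vzero hb"
proof -
  interpret L: cx_algebra "CatLoc hb" by (rule CatLoc_cx_algebra)
  have vscale_0: "vscale hb 0 X = vzero hb" if "X \<in> VF hb" for X
    using VF_closed[OF that] by (simp add: vscale_def vzero_def L.smult_zero_scalar)
  have "nabla d (Phi hb) \<in> VF hb" "nabla d (vscale hb 0 (Phi hb)) = vscale hb 0 (nabla d (Phi hb))"
    using c d Phi_VF by (auto simp: connection_def)
  \<comment> \<open>\<open>vscale_0\<close> is used on both sides: at \<open>Phi hb\<close> and at
    its derivative, which again lies in \<open>VF hb\<close>.\<close>
  then show ?thesis by (simp add: vscale_0 Phi_VF)
qed

text \<open>Here \<open>d\<close> scales \<open>X\<close> and \<open>d'\<close> kills it. Only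
  differentiating along \<open>d\<close> first contributes, so the sign depends on the order of the
  directions; both orders are needed because \<open>del hb\<close> scales \<open>Phi hb\<close>
  while \<open>delbar hb\<close> scales \<open>Phibar hb\<close>.\<close>

lemma curvature_half_flat:
  assumes c: "connection hb nabla" and d: "d \<in> lie_g hb" "d' \<in> lie_g hb"
    and X: "X \<in> VF hb" and a: "a \<in> carrier (CatLoc hb)" "d' a \<in> carrier (CatLoc hb)"
    and nX: "nabla d X = vmul hb X a" "nabla d' X = vzero hb"
  shows "curvature hb nabla d d' X = vneg hb (vmul hb X (d' a))"
    and "curvature hb nabla d' d X = vmul hb X (d' a)"
proof -
  interpret L: cx_algebra "CatLoc hb" by (rule CatLoc_cx_algebra)
  \<comment> \<open>Leibniz rule for \<open>vmul hb X a\<close>, with the derivative of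
    \<open>X\<close> along \<open>d'\<close> already replaced by zero.\<close>
  have "nabla d' (nabla d X) = vadd hb (vmul hb (vzero hb) a) (vmul hb X (d' a))"
    using c d X a(1) nX by (auto simp: connection_def)
  then have n: "nabla d' (nabla d X) = vmul hb X (d' a)"
    using a VF_closed[OF X] by (simp add: vadd_def vmul_def vzero_def)
  show "curvature hb nabla d d' X = vneg hb (vmul hb X (d' a))"
    "curvature hb nabla d' d X = vmul hb X (d' a)"
    using a VF_closed[OF X]
    unfolding curvature_def n nX(2) connection_vzero[OF c d(1)]
    by (simp_all add: vdiff_def vneg_def vzero_def vmul_def L.minus_eq)
qed

theorem mainTheorem2:
  fixes hb :: real
    and S T :: cat_loc_elem
    and h :: "cat_vec \<Rightarrow> cat_vec \<Rightarrow> cat_loc_elem"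
    and nabla :: "(cat_loc_elem \<Rightarrow> cat_loc_elem) \<Rightarrow> cat_vec \<Rightarrow> cat_vec"
  assumes "S \<in> Units (CatLoc hb)" and "T \<in> Units (CatLoc hb)"
    and "hermitian_form hb h"
    and "h (Phi hb) (Phi hb) = S"
    and "h (Phibar hb) (Phibar hb) = T"
    and "h (Phi hb) (Phibar hb) = \<zero>\<^bsub>CatLoc hb\<^esub>"
    and "connection hb nabla"
    and "nabla (del hb) (Phi hb) = vmul hb (Phi hb) (inv\<^bsub>CatLoc hb\<^esub> S \<otimes>\<^bsub>CatLoc hb\<^esub> del hb S)"
    and "nabla (delbar hb) (Phibar hb) =
           vmul hb (Phibar hb) (inv\<^bsub>CatLoc hb\<^esub> T \<otimes>\<^bsub>CatLoc hb\<^esub> delbar hb T)"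
    and "nabla (delbar hb) (Phi hb) = vzero hb"
    and "nabla (del hb) (Phibar hb) = vzero hb"
  shows "curvature hb nabla (del hb) (delbar hb) (Phi hb) =
           vneg hb (vmul hb (Phi hb) (delbar hb (inv\<^bsub>CatLoc hb\<^esub> S \<otimes>\<^bsub>CatLoc hb\<^esub> del hb S)))
       \<and> curvature hb nabla (del hb) (delbar hb) (Phibar hb) =
           vmul hb (Phibar hb) (del hb (inv\<^bsub>CatLoc hb\<^esub> T \<otimes>\<^bsub>CatLoc hb\<^esub> delbar hb T))"
proof -
  interpret L: cx_algebra "CatLoc hb" by (rule CatLoc_cx_algebra)
  have cl: "inv\<^bsub>CatLoc hb\<^esub> S \<otimes>\<^bsub>CatLoc hb\<^esub> del hb S \<in> carrier (CatLoc hb)"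
    "inv\<^bsub>CatLoc hb\<^esub> T \<otimes>\<^bsub>CatLoc hb\<^esub> delbar hb T \<in> carrier (CatLoc hb)"
    using assms(1,2) by (simp_all add: del_closed L.Units_closed)
  show ?thesis
    using curvature_half_flat(1)[OF assms(7) del_lie_g Phi_VF(1) cl(1) del_closed(2)[OF cl(1)]
        assms(8,10)]
      \<comment> \<open>The roles are swapped: \<open>d\<close> is \<open>delbar hb\<close> and
        \<open>d'\<close> is \<open>del hb\<close>, hence the positive sign.\<close>
      curvature_half_flat(2)[OF assms(7) del_lie_g(2,1) Phi_VF(2) cl(2) del_closed(1)[OF cl(2)]
        assms(9,11)]
    by blast
qed

end
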